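(* Each of the intervals \[ [\mathsf{V}(S_c(ab)),\mathsf{V}(S_c(ab)^0)] \qquad\text{and}\qquad [\mathsf{V}(M_2,S_c(ab)),\mathsf{V}(M_2^0,S_c(ab)^0)] \] contains exactly one finitely based variety, namely its least member.
   Context: An ai-semiring is an algebra $(S,+,\cdot)$ such that $(S,+)$ is a commutative idempotent semigroup, $(S,\cdot)$ is a semigroup, and multiplication distributes over addition on both sides. $\mathsf{V}(S_1,\dots,S_k)$ denotes the variety generated by $S_1,\dots,S_k$. For varieties $\mathcal A\le\mathcal B$ (inclusion), $[\mathcal A,\mathcal B]$ is the set of varieties $\mathcal V$ with $\mathcal A\le\mathcal V\le\mathcal B$. A variety is finitely based if it can be defined by a finite set of identities. $M_2$ is the ai-semiring on $\{0,1\}$ with $x+y=xy=\max(x,y)$. $S_c(ab)=\{a,b,ab,\infty\}$ is the commutative ai-semiring with $u+u=u$, $u+v=\infty$ for $u\ne v$, $a\cdot b=b\cdot a=ab$ and all other products equal to $\infty$. For an ai-semiring $S$, $S^0$ denotes $S\cup\{0\}$, where $0$ is a new element (even if $S$ already has an element named $0$) with $0+s=s+0=s$ and $0s=s0=0$ for all $s\in S\cup\{0\}$. *)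

theory Defs
  imports Main "HOL-Library.FuncSet" "HOL-Library.Infinite_Typeclass"
begin

record 'a alg =
  carrier :: "'a set"
  add :: "'a \<Rightarrow> 'a \<Rightarrow> 'a"
  mul :: "'a \<Rightarrow> 'a \<Rightarrow> 'a"

locale ai_semiring =
  fixes S :: "'a alg"
  assumes nonempty: "carrier S \<noteq> {}"
    and add_closed: "x \<in> carrier S \<Longrightarrow> y \<in> carrier S \<Longrightarrow> add S x y \<in> carrier S"
    and mul_closed: "x \<in> carrier S \<Longrightarrow> y \<in> carrier S \<Longrightarrow> mul S x y \<in> carrier S"
    and add_assoc: "x \<in> carrier S \<Longrightarrow> y \<in> carrier S \<Longrightarrow> z \<in> carrier S \<Longrightarrow>
        add S (add S x y) z = add S x (add S y z)"
    and add_comm: "x \<in> carrier S \<Longrightarrow> y \<in> carrier S \<Longrightarrow> add S x y = add S y x"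
    and add_idem: "x \<in> carrier S \<Longrightarrow> add S x x = x"
    and mul_assoc: "x \<in> carrier S \<Longrightarrow> y \<in> carrier S \<Longrightarrow> z \<in> carrier S \<Longrightarrow>
        mul S (mul S x y) z = mul S x (mul S y z)"
    and distrib_left: "x \<in> carrier S \<Longrightarrow> y \<in> carrier S \<Longrightarrow> z \<in> carrier S \<Longrightarrow>
        mul S x (add S y z) = add S (mul S x y) (mul S x z)"
    and distrib_right: "x \<in> carrier S \<Longrightarrow> y \<in> carrier S \<Longrightarrow> z \<in> carrier S \<Longrightarrow>
        mul S (add S x y) z = add S (mul S x z) (mul S y z)"

definition M2 :: "nat alg" where
  "M2 = \<lparr>carrier = {0, 1}, add = max, mul = max\<rparr>"

datatype ab_elem = El_a | El_b | El_ab | El_inf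

definition Sc_ab :: "ab_elem alg" where
  "Sc_ab = \<lparr>carrier = UNIV,
     add = (\<lambda>u v. if u = v then u else El_inf),
     mul = (\<lambda>u v. if (u, v) \<in> {(El_a, El_b), (El_b, El_a)} then El_ab else El_inf)\<rparr>"

text \<open>
  \<open>adjoin_zero S\<close> is \<open>S\<^sup>0\<close>. The new element is \<open>None\<close>, hence always distinct from the
  elements of \<open>S\<close>.
\<close>

fun zero_add :: "('a \<Rightarrow> 'a \<Rightarrow> 'a) \<Rightarrow> 'a option \<Rightarrow> 'a option \<Rightarrow> 'a option" where
  "zero_add f None v = v"
| "zero_add f u None = u"
| "zero_add f (Some x) (Some y) = Some (f x y)"

fun zero_mul :: "('a \<Rightarrow> 'a \<Rightarrow> 'a) \<Rightarrow> 'a option \<Rightarrow> 'a option \<Rightarrow> 'a option" where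
  "zero_mul f None v = None"
| "zero_mul f u None = None"
| "zero_mul f (Some x) (Some y) = Some (f x y)"

definition adjoin_zero :: "'a alg \<Rightarrow> 'a option alg" where
  "adjoin_zero S = \<lparr>carrier = insert None (Some ` carrier S),
     add = zero_add (add S), mul = zero_mul (mul S)\<rparr>"

definition alg_hom :: "'a alg \<Rightarrow> 'b alg \<Rightarrow> ('a \<Rightarrow> 'b) set" where
  "alg_hom S T = {h. h ` carrier S \<subseteq> carrier T \<and>
     (\<forall>x\<in>carrier S. \<forall>y\<in>carrier S.
        h (add S x y) = add T (h x) (h y) \<and> h (mul S x y) = mul T (h x) (h y))}"

definition isomorphic :: "'a alg \<Rightarrow> 'b alg \<Rightarrow> bool" where
  "isomorphic S T \<longleftrightarrow> (\<exists>h\<in>alg_hom S T. bij_betw h (carrier S) (carrier T))"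

definition hom_image :: "'a alg \<Rightarrow> 'b alg \<Rightarrow> bool" where
  "hom_image T S \<longleftrightarrow> (\<exists>h\<in>alg_hom S T. h ` carrier S = carrier T)"

definition subalgebra :: "'a alg \<Rightarrow> 'a alg \<Rightarrow> bool" where
  "subalgebra T S \<longleftrightarrow> carrier T \<noteq> {} \<and> carrier T \<subseteq> carrier S \<and> add T = add S \<and> mul T = mul S \<and>
     (\<forall>x\<in>carrier T. \<forall>y\<in>carrier T. add S x y \<in> carrier T \<and> mul S x y \<in> carrier T)"

definition product :: "'i set \<Rightarrow> ('i \<Rightarrow> 'a alg) \<Rightarrow> ('i \<Rightarrow> 'a) alg" where
  "product I S = \<lparr>carrier = (\<Pi>\<^sub>E i\<in>I. carrier (S i)),
     add = (\<lambda>f g. \<lambda>i\<in>I. add (S i) (f i) (g i)),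
     mul = (\<lambda>f g. \<lambda>i\<in>I. mul (S i) (f i) (g i))\<rparr>"

text \<open>
  The algebras in a class have their carriers inside an arbitrary infinite type \<open>'u\<close>, the
  universe. Infinite products of such algebras do not fit into \<open>'u\<close> in general, so closure under
  the three class operators is expressed by closure under their composite HSP: the intermediate
  products and their subalgebras live in \<open>'u \<Rightarrow> 'u\<close>, and only the resulting homomorphic image has
  to lie in \<open>'u\<close>. Restricting the index sets to subsets of \<open>'u\<close> is harmless: an algebra over \<open>'u\<close>
  is an image of a free algebra on at most \<open>|'u|\<close> generators, and the latter is a subdirect
  product of at most \<open>|'u|\<close> members of the class. The empty index set is allowed, so that every
  variety contains the trivial algebras.
\<close>

definition HSP :: "'u alg set \<Rightarrow> 'u alg set" where
  "HSP K = {T. \<exists>(I :: 'u set) A P. A ` I \<subseteq> K \<and> subalgebra P (product I A) \<and> hom_image T P}"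

definition variety :: "'u alg set \<Rightarrow> bool" where
  "variety K \<longleftrightarrow> (\<forall>S\<in>K. ai_semiring S) \<and> HSP K \<subseteq> K"

definition generated_variety :: "'u alg set \<Rightarrow> 'u alg set" where
  "generated_variety G = \<Inter> {K. variety K \<and> G \<subseteq> K}"

text \<open>
  The generators live on types of their own, so they enter a class through their isomorphic
  copies inside the universe.
\<close>

definition copies :: "'a alg \<Rightarrow> 'u alg set" where
  "copies S = {T. isomorphic S T}"

definition variety_interval :: "'u alg set \<Rightarrow> 'u alg set \<Rightarrow> 'u alg set set" where
  "variety_interval A B = {K. variety K \<and> A \<subseteq> K \<and> K \<subseteq> B}"

datatype trm = Var nat | Add trm trm | Mul trm trm

primrec eval :: "'a alg \<Rightarrow> (nat \<Rightarrow> 'a) \<Rightarrow> trm \<Rightarrow> 'a" where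
  "eval S \<sigma> (Var n) = \<sigma> n"
| "eval S \<sigma> (Add s t) = add S (eval S \<sigma> s) (eval S \<sigma> t)"
| "eval S \<sigma> (Mul s t) = mul S (eval S \<sigma> s) (eval S \<sigma> t)"

definition satisfies :: "'a alg \<Rightarrow> trm \<times> trm \<Rightarrow> bool" where
  "satisfies S e \<longleftrightarrow> (\<forall>\<sigma>. range \<sigma> \<subseteq> carrier S \<longrightarrow> eval S \<sigma> (fst e) = eval S \<sigma> (snd e))"

definition finitely_based :: "'u alg set \<Rightarrow> bool" where
  "finitely_based K \<longleftrightarrow> (\<exists>E. finite E \<and> K = {S. ai_semiring S \<and> (\<forall>e\<in>E. satisfies S e)})"

lemma ai_semiring_M2: "ai_semiring M2"
  by unfold_locales (auto simp: M2_def)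

lemma ai_semiring_Sc_ab: "ai_semiring Sc_ab"
  by unfold_locales (auto simp: Sc_ab_def split: if_splits)

lemma ai_semiring_adjoin_zero:
  assumes "ai_semiring S"
  shows "ai_semiring (adjoin_zero S)"
proof -
  interpret ai_semiring S by fact
  show ?thesis
    by unfold_locales
      (auto simp: adjoin_zero_def add_closed mul_closed add_assoc add_idem mul_assoc
        distrib_left distrib_right intro: add_comm)
qed

lemma ai_semiring_hom_image:
  assumes "ai_semiring S" "hom_image T S"
  shows "ai_semiring T"
proof -
  interpret S: ai_semiring S by fact
  obtain h where h: "h \<in> alg_hom S T" "h ` carrier S = carrier T"
    using assms(2) by (auto simp: hom_image_def)
  have im: "carrier T = h ` carrier S"
    using h(2) by simp
  have hom: "add T (h x) (h y) = h (add S x y)" "mul T (h x) (h y) = h (mul S x y)"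
    if "x \<in> carrier S" "y \<in> carrier S" for x y
    using h(1) that by (auto simp: alg_hom_def)
  show ?thesis
    by unfold_locales
      (auto simp: im hom S.nonempty S.add_closed S.mul_closed S.add_assoc S.add_idem S.mul_assoc
        S.distrib_left S.distrib_right intro: arg_cong[OF S.add_comm, of _ _ h])
qed

lemma ai_semiring_subalgebra:
  assumes "ai_semiring S" "subalgebra T S"
  shows "ai_semiring T"
proof -
  interpret S: ai_semiring S by fact
  have sub: "\<And>x. x \<in> carrier T \<Longrightarrow> x \<in> carrier S" and ops: "add T = add S" "mul T = mul S"
    and cl: "carrier T \<noteq> {}"
      "\<And>x y. x \<in> carrier T \<Longrightarrow> y \<in> carrier T \<Longrightarrow> add S x y \<in> carrier T"
      "\<And>x y. x \<in> carrier T \<Longrightarrow> y \<in> carrier T \<Longrightarrow> mul S x y \<in> carrier T"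
    using assms(2) by (auto simp: subalgebra_def)
  show ?thesis
    by unfold_locales
      (auto simp: ops sub cl S.add_assoc S.add_idem S.mul_assoc S.distrib_left S.distrib_right
        intro: S.add_comm)
qed

lemma ai_semiring_product:
  assumes "\<And>i. i \<in> I \<Longrightarrow> ai_semiring (A i)"
  shows "ai_semiring (product I A)"
proof -
  note ax = assms[THEN ai_semiring.add_closed] assms[THEN ai_semiring.mul_closed]
    assms[THEN ai_semiring.add_assoc] assms[THEN ai_semiring.add_idem]
    assms[THEN ai_semiring.mul_assoc] assms[THEN ai_semiring.distrib_left]
    assms[THEN ai_semiring.distrib_right]
  show ?thesis
    by unfold_locales
      (auto simp: product_def PiE_iff PiE_eq_empty_iff ax
        extensional_def fun_eq_iff restrict_def assms[THEN ai_semiring.nonempty]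
        intro: assms[THEN ai_semiring.add_comm])
qed

lemma HSP_mono: "K \<subseteq> L \<Longrightarrow> HSP K \<subseteq> HSP L"
  unfolding HSP_def by (intro Collect_mono impI) (elim exE conjE, intro exI conjI, rule subset_trans)

lemma variety_all: "variety {S. ai_semiring S}"
proof -
  have "ai_semiring T" if "T \<in> HSP {S. ai_semiring S}" for T :: "'a alg"
  proof -
    obtain I :: "'a set" and A :: "'a \<Rightarrow> 'a alg" and P where A: "A ` I \<subseteq> {S. ai_semiring S}"
      and P: "subalgebra P (product I A)" and T: "hom_image T P"
      using \<open>T \<in> _\<close> unfolding HSP_def by (elim CollectE exE conjE)
    have "ai_semiring (product I A)"
      using A by (intro ai_semiring_product) auto
    then show ?thesis
      using P T ai_semiring_subalgebra ai_semiring_hom_image by metis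
  qed
  then show ?thesis
    by (auto simp: variety_def)
qed

lemma variety_generated_variety:
  assumes "\<And>S. S \<in> G \<Longrightarrow> ai_semiring S"
  shows "variety (generated_variety G)"
  unfolding variety_def
proof
  have "generated_variety G \<subseteq> {S. ai_semiring S}"
    unfolding generated_variety_def using variety_all assms by (intro Inter_lower) auto
  then show "\<forall>S\<in>generated_variety G. ai_semiring S"
    by auto
  have "HSP (generated_variety G) \<subseteq> K" if "variety K" "G \<subseteq> K" for K
  proof -
    have "generated_variety G \<subseteq> K"
      unfolding generated_variety_def using that by (intro Inter_lower) simp
    then have "HSP (generated_variety G) \<subseteq> HSP K"
      by (rule HSP_mono)
    with that(1) show ?thesis
      unfolding variety_def by (meson subset_trans)
  qed
  then show "HSP (generated_variety G) \<subseteq> generated_variety G"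
    by (subst (2) generated_variety_def) (intro Inter_greatest, simp)
qed

lemma ai_semiring_copies: "ai_semiring S \<Longrightarrow> T \<in> copies S \<Longrightarrow> ai_semiring T"
  by (rule ai_semiring_hom_image[of S])
    (auto simp: copies_def isomorphic_def hom_image_def bij_betw_def)

end

theory Submission
  imports Defs "HOL-Library.Multiset"
begin

text \<open>
  The proof reads the monomials of length two of a term as the edges of a graph on its variables.
  An assignment into \<open>S\<^sub>c(ab)\<close> gives such a sum of edges a finite value, one different from \<open>\<infinity>\<close>,
  only if it is a proper 2-colouring of the graph. Two terms with a finite value are therefore
  identified by \<open>S\<^sub>c(ab)\<close> if and only if they have the same variables as monomials and the same
  2-colourings, that is, if one graph arises from the other by adding and removing edges between
  vertices that are joined by another walk of odd length. The path law \<open>pq + qr + ru \<ge> pu\<close>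
  generates exactly these changes, and whether it holds decides everything.

  A variety in one of the intervals that satisfies the path law is the least member. The
  identities of the greatest member still distinguish terms that become different when variables
  are deleted; the path law removes this distinction, and together they yield a finite basis of
  the least member (\<open>M2_Sc_model_if_path_law\<close>, \<open>Sc_model_if_path_law\<close>). That these identities are
  a basis is a completeness argument: monomials of a term with finite value are recovered by
  recolouring (\<open>le_geval_if_Sc_finite\<close>), while a term without finite value has, up to the
  identities, either a summand that plays the role of \<open>\<infinity>\<close> or else a proper 2-colouring after all
  (\<open>cube_below_if_Sc_infinite\<close>). Birkhoff's theorem turns completeness into membership.

  A variety \<open>K\<close> in one of the intervals that violates the path law is not finitely based. A
  nontrivial identity of \<open>K\<close> between terms with finite value would fold onto the path law, so \<open>K\<close>
  has none (\<open>law_fails_path_law\<close>). An odd cycle has no proper 2-colouring, but becomes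
  2-colourable when a vertex is deleted; hence \<open>K\<close> satisfies the identity that adds the product of
  all vertices to the sum of the edges of an odd cycle. An identity with few variables cannot see
  that a long cycle closes up: it meets only proper parts, which are 2-colourable, and there it is
  trivial. This is made precise by a finite algebra of divisors of the cycle, in which all short
  identities of \<open>K\<close> hold and the identity of the cycle fails (\<open>path_law_if_finitely_based\<close>).
\<close>

section \<open>Terms over arbitrary variables and Birkhoff's theorem\<close>

text \<open>
  Recovering an algebra of a variety from the identities of the variety takes one variable for
  each of its elements, so terms are needed over variable types other than \<^typ>\<open>nat\<close>.
\<close>

datatype 'v gterm = GVar 'v | GAdd "'v gterm" "'v gterm" | GMul "'v gterm" "'v gterm"

primrec geval :: "'a alg \<Rightarrow> ('v \<Rightarrow> 'a) \<Rightarrow> 'v gterm \<Rightarrow> 'a" where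
  "geval S \<sigma> (GVar x) = \<sigma> x"
| "geval S \<sigma> (GAdd s t) = add S (geval S \<sigma> s) (geval S \<sigma> t)"
| "geval S \<sigma> (GMul s t) = mul S (geval S \<sigma> s) (geval S \<sigma> t)"

primrec gterm_of :: "trm \<Rightarrow> nat gterm" where
  "gterm_of (Var n) = GVar n"
| "gterm_of (Add s t) = GAdd (gterm_of s) (gterm_of t)"
| "gterm_of (Mul s t) = GMul (gterm_of s) (gterm_of t)"

definition law :: "'a alg \<Rightarrow> 'v gterm \<Rightarrow> 'v gterm \<Rightarrow> bool" where
  "law S s t \<longleftrightarrow> (\<forall>\<sigma>. range \<sigma> \<subseteq> carrier S \<longrightarrow> geval S \<sigma> s = geval S \<sigma> t)"

lemma geval_gterm_of: "geval S \<sigma> (gterm_of t) = eval S \<sigma> t"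
  by (induction t) auto

lemma satisfies_iff_law: "satisfies S e \<longleftrightarrow> law S (gterm_of (fst e)) (gterm_of (snd e))"
  by (simp add: satisfies_def law_def geval_gterm_of)

lemma law_sym: "law S s t \<longleftrightarrow> law S t s"
  by (auto simp: law_def)

lemma (in ai_semiring) geval_closed:
  assumes "range \<sigma> \<subseteq> carrier S"
  shows "geval S \<sigma> t \<in> carrier S"
  using assms by (induction t) (auto simp: add_closed mul_closed)

lemma geval_hom:
  assumes "ai_semiring S" "h \<in> alg_hom S T" "range \<sigma> \<subseteq> carrier S"
  shows "geval T (\<lambda>x. h (\<sigma> x)) t = h (geval S \<sigma> t)"
proof -
  have "h (add S x y) = add T (h x) (h y)" "h (mul S x y) = mul T (h x) (h y)"
    if "x \<in> carrier S" "y \<in> carrier S" for x y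
    using assms(2) that unfolding alg_hom_def by blast+
  then show ?thesis
    using ai_semiring.geval_closed[OF assms(1,3)] by (induction t) simp_all
qed

lemma law_hom_image:
  assumes "ai_semiring S" "hom_image T S" "law S s t"
  shows "law T s t"
  unfolding law_def
proof (intro allI impI)
  fix \<tau> :: "'c \<Rightarrow> 'b" assume \<tau>: "range \<tau> \<subseteq> carrier T"
  obtain h where h: "h \<in> alg_hom S T" "h ` carrier S = carrier T"
    using assms(2) by (auto simp: hom_image_def)
  define \<sigma> where "\<sigma> x = inv_into (carrier S) h (\<tau> x)" for x
  have "\<tau> x \<in> h ` carrier S" for x
    using \<tau> h(2) by auto
  then have \<sigma>_in: "\<sigma> x \<in> carrier S" and h_\<sigma>: "h (\<sigma> x) = \<tau> x" for x
    unfolding \<sigma>_def by (rule inv_into_into, rule f_inv_into_f)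
  have \<sigma>: "range \<sigma> \<subseteq> carrier S"
    using \<sigma>_in by blast
  have eq: "geval T \<tau> t = h (geval S \<sigma> t)" for t
    using geval_hom[OF assms(1) h(1) \<sigma>, of t] by (simp add: h_\<sigma>)
  have "geval S \<sigma> s = geval S \<sigma> t"
    using assms(3) \<sigma> unfolding law_def by blast
  then show "geval T \<tau> s = geval T \<tau> t"
    by (simp add: eq)
qed

lemma law_copies:
  assumes "ai_semiring S" "T \<in> copies S"
  shows "law T s t \<longleftrightarrow> law S s t"
proof
  obtain h where h: "h \<in> alg_hom S T" "bij_betw h (carrier S) (carrier T)"
    using assms(2) by (auto simp: copies_def isomorphic_def)
  show "law T s t" if "law S s t"
    using law_hom_image[OF assms(1) _ that] h by (auto simp: hom_image_def bij_betw_def)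
  show "law S s t" if T: "law T s t"
    unfolding law_def
  proof (intro allI impI)
    fix \<sigma> :: "'c \<Rightarrow> 'a" assume \<sigma>: "range \<sigma> \<subseteq> carrier S"
    then have "range (\<lambda>x. h (\<sigma> x)) \<subseteq> carrier T"
      using h(2) by (auto simp: bij_betw_def)
    then have "geval T (\<lambda>x. h (\<sigma> x)) s = geval T (\<lambda>x. h (\<sigma> x)) t"
      using T unfolding law_def by blast
    then have "h (geval S \<sigma> s) = h (geval S \<sigma> t)"
      by (simp add: geval_hom[OF assms(1) h(1) \<sigma>])
    then show "geval S \<sigma> s = geval S \<sigma> t"
      using h(2) ai_semiring.geval_closed[OF assms(1) \<sigma>] by (meson bij_betw_def inj_on_def)
  qed
qed

lemma satisfies_copies: "ai_semiring S \<Longrightarrow> T \<in> copies S \<Longrightarrow> satisfies T e \<longleftrightarrow> satisfies S e"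
  unfolding satisfies_iff_law by (rule law_copies)

lemma geval_product:
  assumes "\<And>x. \<sigma> x \<in> extensional I"
  shows "geval (product I A) \<sigma> t = (\<lambda>i\<in>I. geval (A i) (\<lambda>x. \<sigma> x i) t)"
proof (induction t)
  case (GVar x)
  then show ?case using extensional_restrict[OF assms] by simp
qed (auto simp: product_def fun_eq_iff)

lemma geval_subalgebra: "subalgebra P S \<Longrightarrow> geval P \<sigma> t = geval S \<sigma> t"
  by (induction t) (auto simp: subalgebra_def)

lemma law_HSP:
  fixes K :: "'u alg set" and s t :: "'v gterm"
  assumes K: "\<And>S. S \<in> K \<Longrightarrow> ai_semiring S \<and> law S s t" and T: "T \<in> HSP K"
  shows "law T s t"
proof -
  obtain I :: "'u set" and A :: "'u \<Rightarrow> 'u alg" and P where A: "A ` I \<subseteq> K" and P: "subalgebra P (product I A)" and T: "hom_image T P"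
    using T unfolding HSP_def by (elim CollectE exE conjE)
  have ai: "ai_semiring (product I A)"
    using A K by (intro ai_semiring_product) auto
  have "law P s t"
    unfolding law_def
  proof (intro allI impI)
    fix \<sigma> :: "'v \<Rightarrow> 'u \<Rightarrow> 'u" assume "range \<sigma> \<subseteq> carrier P"
    moreover have "carrier P \<subseteq> (\<Pi>\<^sub>E i\<in>I. carrier (A i))"
      using P by (simp add: subalgebra_def product_def)
    ultimately have \<sigma>: "\<sigma> x \<in> (\<Pi>\<^sub>E i\<in>I. carrier (A i))" for x
      by blast
    then have ext: "\<sigma> x \<in> extensional I" for x
      by (auto simp: PiE_def)
    have "geval (A i) (\<lambda>x. \<sigma> x i) s = geval (A i) (\<lambda>x. \<sigma> x i) t" if "i \<in> I" for i
    proof -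
      have "law (A i) s t"
        using K A that by blast
      moreover have "range (\<lambda>x. \<sigma> x i) \<subseteq> carrier (A i)"
        using \<sigma> that by (auto simp: PiE_iff)
      ultimately show ?thesis
        unfolding law_def by blast
    qed
    then show "geval P \<sigma> s = geval P \<sigma> t"
      by (simp add: geval_subalgebra[OF P] geval_product ext cong: restrict_cong)
  qed
  then show ?thesis
    by (rule law_hom_image[OF ai_semiring_subalgebra[OF ai P] T])
qed

lemma variety_models: "variety {S. ai_semiring S \<and> (\<forall>e\<in>E. satisfies S e)}" (is "variety ?K")
proof -
  have "ai_semiring T" if "T \<in> HSP ?K" for T
    using that HSP_mono[of ?K "{S. ai_semiring S}"] variety_all unfolding variety_def by blast
  moreover have "satisfies T e" if "T \<in> HSP ?K" "e \<in> E" for T e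
    unfolding satisfies_iff_law by (rule law_HSP[OF _ that(1)]) (use that(2) in \<open>auto simp: satisfies_iff_law\<close>)
  ultimately have "HSP ?K \<subseteq> ?K"
    by blast
  then show ?thesis
    unfolding variety_def by blast
qed

lemma subset_generated_variety: "G \<subseteq> generated_variety G"
  by (auto simp: generated_variety_def)

lemma generated_variety_subset: "variety K \<Longrightarrow> G \<subseteq> K \<Longrightarrow> generated_variety G \<subseteq> K"
  by (auto simp: generated_variety_def)

lemma generated_variety_models:
  assumes "\<And>S. S \<in> G \<Longrightarrow> ai_semiring S \<and> satisfies S e" "T \<in> generated_variety G"
  shows "satisfies T e"
  using generated_variety_subset[OF variety_models[of "{e}"], of G] assms by auto

lemma ex_copy:
  fixes S :: "'a alg"
  assumes "finite (carrier S)"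
  shows "\<exists>T :: 'u::infinite alg. T \<in> copies S"
proof -
  obtain B :: "'u set" where B: "finite B" "card B = card (carrier S)"
    using infinite_arbitrarily_large[OF infinite_UNIV] by blast
  then obtain f where f: "bij_betw f (carrier S) B"
    using assms finite_same_card_bij by metis
  define g where "g = the_inv_into (carrier S) f"
  have g: "g (f x) = x" if "x \<in> carrier S" for x
    using f that by (simp add: g_def bij_betw_def the_inv_into_f_f)
  define T where "T = \<lparr>carrier = B, add = \<lambda>u v. f (add S (g u) (g v)),
      mul = \<lambda>u v. f (mul S (g u) (g v))\<rparr>"
  have "f \<in> alg_hom S T"
    using f by (auto simp: alg_hom_def T_def g bij_betw_def)
  moreover have "bij_betw f (carrier S) (carrier T)"
    using f by (simp add: T_def)
  ultimately show ?thesis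
    by (auto simp: copies_def isomorphic_def)
qed

text \<open>
  Terms over an infinite type are no more numerous than the elements of the type, because a
  pairing function lets them be encoded. This is what makes the index set of the product in
  Birkhoff's theorem fit into the universe.
\<close>

lemma ex_inj_gterm_pairs: "\<exists>f :: 'u::infinite gterm \<times> 'u gterm \<Rightarrow> 'u. inj f"
proof -
  obtain p :: "'u \<times> 'u \<Rightarrow> 'u" where "bij_betw p (UNIV \<times> UNIV) UNIV"
    using card_of_Times_same_infinite[OF infinite_UNIV[where 'a = 'u]] card_of_ordIso by blast
  then have p: "inj p"
    by (simp add: bij_betw_def)
  obtain B :: "'u set" where B: "finite B" "card B = 3"
    using infinite_arbitrarily_large[OF infinite_UNIV] by blast
  then obtain a b c :: 'u where abc: "a \<noteq> b" "b \<noteq> c" "a \<noteq> c"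
    using card_3_iff by metis
  define enc where "enc = rec_gterm (\<lambda>x. p (a, x)) (\<lambda>_ _ u v. p (b, p (u, v))) (\<lambda>_ _ u v. p (c, p (u, v)))"
  have enc[simp]: "enc (GVar x) = p (a, x)" "enc (GAdd s t) = p (b, p (enc s, enc t))"
    "enc (GMul s t) = p (c, p (enc s, enc t))" for x s t
    by (auto simp: enc_def)
  have p_eq[simp]: "p x = p y \<longleftrightarrow> x = y" for x y
    using p by (rule inj_eq)
  have "enc s = enc t \<Longrightarrow> s = t" for s t
  proof (induction s arbitrary: t)
    case (GVar x) then show ?case using abc by (cases t) auto
  next
    case (GAdd s1 s2) then show ?case using abc by (cases t) auto
  next
    case (GMul s1 s2) then show ?case using abc by (cases t) auto
  qed
  then have "inj (\<lambda>(s, t). p (enc s, enc t))"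
    by (auto simp: inj_def)
  then show ?thesis by blast
qed

text \<open>
  For every pair of terms that is not an identity of \<open>K\<close>, choose a member of \<open>K\<close> and an
  assignment that separate the two. In the product of these members, the family of the chosen
  assignments satisfies only the identities of \<open>K\<close>, so the subalgebra that it generates is free,
  and it maps onto every algebra that satisfies the identities of \<open>K\<close>.
\<close>

theorem Birkhoff:
  fixes K :: "'u::infinite alg set"
  assumes K: "variety K" and T: "ai_semiring T"
    and laws: "\<And>s t :: 'u gterm. (\<And>S. S \<in> K \<Longrightarrow> law S s t) \<Longrightarrow> law T s t"
  shows "T \<in> K"
proof -
  obtain enc :: "'u gterm \<times> 'u gterm \<Rightarrow> 'u" where enc: "inj enc"
    using ex_inj_gterm_pairs by blast
  define sep where "sep p S \<tau> \<longleftrightarrow> S \<in> K \<and> range \<tau> \<subseteq> carrier S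
      \<and> geval S \<tau> (fst p) \<noteq> geval S \<tau> (snd p)" for p :: "'u gterm \<times> 'u gterm" and S and \<tau> :: "'u \<Rightarrow> 'u"
  define J where "J = {p. \<exists>S \<tau>. sep p S \<tau>}"
  define I where "I = enc ` J"
  define c where "c i = (SOME q. sep (inv enc i) (fst q) (snd q))" for i
  define A where "A i = fst (c i)" for i
  define \<tau> where "\<tau> i = snd (c i)" for i
  have sep: "sep (inv enc i) (A i) (\<tau> i)" if "i \<in> I" for i
  proof -
    have "inv enc i \<in> J"
      using that enc by (auto simp: I_def)
    then have "\<exists>q. sep (inv enc i) (fst q) (snd q)"
      by (auto simp: J_def)
    then show ?thesis
      unfolding A_def \<tau>_def c_def by (rule someI_ex)
  qed
  define Q where "Q = product I A"
  define g where "g x = (\<lambda>i\<in>I. \<tau> i x)" for x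
  have geval_Q: "geval Q g t = (\<lambda>i\<in>I. geval (A i) (\<tau> i) t)" for t
    unfolding Q_def by (subst geval_product) (auto simp: g_def fun_eq_iff)
  have ai: "ai_semiring (A i)" if "i \<in> I" for i
    using sep[OF that] K by (auto simp: sep_def variety_def)
  have Q: "ai_semiring Q"
    unfolding Q_def using ai by (rule ai_semiring_product)
  have g: "range g \<subseteq> carrier Q"
    using sep by (force simp: g_def Q_def product_def sep_def)
  define P where "P = Q\<lparr>carrier := range (geval Q g)\<rparr>"
  have "add Q (geval Q g s) (geval Q g t) \<in> range (geval Q g)"
       "mul Q (geval Q g s) (geval Q g t) \<in> range (geval Q g)" for s t
    using rangeI[of "geval Q g" "GAdd s t"] rangeI[of "geval Q g" "GMul s t"] by auto
  then have P: "subalgebra P Q"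
    using ai_semiring.geval_closed[OF Q g] by (auto simp: subalgebra_def P_def)

  have free: "law T s t" if "geval Q g s = geval Q g t" for s t
  proof (rule laws, rule ccontr)
    fix S assume "S \<in> K" "\<not> law S s t"
    then obtain \<rho> where "sep (s, t) S \<rho>"
      by (auto simp: law_def sep_def)
    then have "enc (s, t) \<in> I"
      by (auto simp: I_def J_def)
    moreover have "inv enc (enc (s, t)) = (s, t)"
      using enc by simp
    ultimately show False
      using fun_cong[OF that, of "enc (s, t)"] sep[of "enc (s, t)"] by (simp add: geval_Q sep_def)
  qed

  obtain z where z: "z \<in> carrier T"
    using ai_semiring.nonempty[OF T] by blast
  define \<sigma> where "\<sigma> x = (if x \<in> carrier T then x else z)" for x
  have \<sigma>: "range \<sigma> \<subseteq> carrier T"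
    using z by (auto simp: \<sigma>_def)
  define h where "h f = geval T \<sigma> (SOME t. geval Q g t = f)" for f
  have h: "h (geval Q g t) = geval T \<sigma> t" for t
  proof -
    have "geval Q g (SOME s. geval Q g s = geval Q g t) = geval Q g t"
      by (rule someI_ex) blast
    then have "law T (SOME s. geval Q g s = geval Q g t) t"
      by (rule free)
    then show ?thesis
      unfolding h_def law_def using \<sigma> by blast
  qed
  have "h \<in> alg_hom P T"
    unfolding alg_hom_def
  proof (intro CollectI conjI ballI)
    show "h ` carrier P \<subseteq> carrier T"
      using ai_semiring.geval_closed[OF T \<sigma>] by (auto simp: P_def h)
    fix x y assume "x \<in> carrier P" "y \<in> carrier P"
    then obtain s t where "x = geval Q g s" "y = geval Q g t"
      by (auto simp: P_def)
    then show "h (add P x y) = add T (h x) (h y)" "h (mul P x y) = mul T (h x) (h y)"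
      using h[of "GAdd s t"] h[of "GMul s t"] by (auto simp: P_def h)
  qed
  moreover have "h ` carrier P = carrier T"
  proof -
    have "x \<in> h ` carrier P" if "x \<in> carrier T" for x
      using that h[of "GVar x"] rangeI[of "geval Q g" "GVar x"] by (auto simp: P_def \<sigma>_def)
    then show ?thesis
      using ai_semiring.geval_closed[OF T \<sigma>] by (auto simp: P_def h)
  qed
  ultimately have "hom_image T P"
    by (auto simp: hom_image_def)
  moreover have "A ` I \<subseteq> K"
    using sep by (auto simp: sep_def)
  ultimately have "A ` I \<subseteq> K \<and> subalgebra P (product I A) \<and> hom_image T P"
    using P by (simp add: Q_def)
  then have "T \<in> HSP K"
    unfolding HSP_def by blast
  then show ?thesis
    using K by (auto simp: variety_def)
qed

section \<open>Commutative ai-semirings and monomials\<close>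

locale comm_ai_semiring = ai_semiring +
  assumes mul_comm: "x \<in> carrier S \<Longrightarrow> y \<in> carrier S \<Longrightarrow> mul S x y = mul S y x"

text \<open>
  The order of the additive semilattice. The value of a term is the least upper bound of the values
  of its monomials, so an identity is proved by comparing single monomials with a term.
\<close>

definition le :: "'a alg \<Rightarrow> 'a \<Rightarrow> 'a \<Rightarrow> bool" where
  "le S x y \<longleftrightarrow> add S x y = y"

context ai_semiring
begin

lemma le_refl: "x \<in> carrier S \<Longrightarrow> le S x x"
  by (simp add: le_def add_idem)

lemma le_trans:
  "le S x y \<Longrightarrow> le S y z \<Longrightarrow> x \<in> carrier S \<Longrightarrow> y \<in> carrier S \<Longrightarrow> z \<in> carrier S \<Longrightarrow> le S x z"
  unfolding le_def by (metis add_assoc)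

lemma le_antisym: "le S x y \<Longrightarrow> le S y x \<Longrightarrow> x \<in> carrier S \<Longrightarrow> y \<in> carrier S \<Longrightarrow> x = y"
  unfolding le_def by (metis add_comm)

lemma add_le:
  "le S x z \<Longrightarrow> le S y z \<Longrightarrow> x \<in> carrier S \<Longrightarrow> y \<in> carrier S \<Longrightarrow> z \<in> carrier S
    \<Longrightarrow> le S (add S x y) z"
  unfolding le_def by (metis add_assoc)

lemma le_add1: "x \<in> carrier S \<Longrightarrow> y \<in> carrier S \<Longrightarrow> le S x (add S x y)"
  unfolding le_def by (metis add_assoc add_idem)

lemma le_add2: "x \<in> carrier S \<Longrightarrow> y \<in> carrier S \<Longrightarrow> le S y (add S x y)"
  using le_add1 by (metis add_comm)

lemma mul_mono_left:
  "le S x y \<Longrightarrow> x \<in> carrier S \<Longrightarrow> y \<in> carrier S \<Longrightarrow> z \<in> carrier S \<Longrightarrow> le S (mul S z x) (mul S z y)"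
  unfolding le_def by (metis distrib_left)

lemma mul_mono_right:
  "le S x y \<Longrightarrow> x \<in> carrier S \<Longrightarrow> y \<in> carrier S \<Longrightarrow> z \<in> carrier S \<Longrightarrow> le S (mul S x z) (mul S y z)"
  unfolding le_def by (metis distrib_right)

end

text \<open>
  Monomials are kept as words, because they need to be compared up to commutation only when they
  have length two.
\<close>

primrec mons :: "'v gterm \<Rightarrow> 'v list set" where
  "mons (GVar x) = {[x]}"
| "mons (GAdd s t) = mons s \<union> mons t"
| "mons (GMul s t) = {u @ v | u v. u \<in> mons s \<and> v \<in> mons t}"

fun mval :: "'a alg \<Rightarrow> ('v \<Rightarrow> 'a) \<Rightarrow> 'v list \<Rightarrow> 'a" where
  "mval S \<sigma> [] = undefined"
| "mval S \<sigma> [x] = \<sigma> x"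
| "mval S \<sigma> (x # y # w) = mul S (\<sigma> x) (mval S \<sigma> (y # w))"

lemma Nil_not_in_mons: "[] \<notin> mons t"
  by (induction t) auto

lemma mons_nonempty: "mons t \<noteq> {}"
  by (induction t) auto

lemma set_mons: "(\<Union>w\<in>mons t. set w) = set_gterm t"
proof (induction t)
  case (GMul s t)
  have "(\<Union>w\<in>mons (GMul s t). set w) = (\<Union>w\<in>mons s. set w) \<union> (\<Union>w\<in>mons t. set w)"
    using mons_nonempty[of s] mons_nonempty[of t] by (fastforce)
  then show ?case using GMul by simp
qed auto

context comm_ai_semiring
begin

lemma mul_left_comm:
  "x \<in> carrier S \<Longrightarrow> y \<in> carrier S \<Longrightarrow> z \<in> carrier S \<Longrightarrow> mul S x (mul S y z) = mul S y (mul S x z)"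
  by (metis mul_assoc mul_comm)

lemmas mul_ac = mul_assoc mul_comm mul_left_comm

context
  fixes \<sigma> :: "'v \<Rightarrow> 'a"
  assumes \<sigma>: "\<sigma> x \<in> carrier S"
begin

lemma mval_closed: "w \<noteq> [] \<Longrightarrow> mval S \<sigma> w \<in> carrier S"
proof (induction w rule: list_nonempty_induct)
  case (cons x w)
  then show ?case by (cases w) (simp_all add: \<sigma> mul_closed)
qed (simp add: \<sigma>)

lemma geval_in: "geval S \<sigma> t \<in> carrier S"
  by (rule geval_closed) (use \<sigma> in blast)

lemma mval_append:
  "u \<noteq> [] \<Longrightarrow> v \<noteq> [] \<Longrightarrow> mval S \<sigma> (u @ v) = mul S (mval S \<sigma> u) (mval S \<sigma> v)"
proof (induction u rule: list_nonempty_induct)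
  case (single x)
  then show ?case by (cases v) auto
next
  case (cons x u)
  then obtain y u' where "u = y # u'"
    by (cases u) auto
  with cons show ?case
    using mval_closed[of u] mval_closed[of v] by (simp add: \<sigma> mul_assoc)
qed

lemma mval_le_geval: "w \<in> mons t \<Longrightarrow> le S (mval S \<sigma> w) (geval S \<sigma> t)"
proof (induction t arbitrary: w)
  case (GVar x)
  then show ?case by (simp add: le_refl \<sigma>)
next
  case (GAdd s t)
  have w: "w \<noteq> []"
    using GAdd.prems Nil_not_in_mons by blast
  consider "w \<in> mons s" | "w \<in> mons t"
    using GAdd.prems by auto
  then show ?case
  proof cases
    case 1
    show ?thesis
      using le_trans[OF GAdd.IH(1)[OF 1] le_add1[of _ "geval S \<sigma> t"]]
      by (simp add: mval_closed w geval_in add_closed)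
  next
    case 2
    show ?thesis
      using le_trans[OF GAdd.IH(2)[OF 2] le_add2[of "geval S \<sigma> s"]]
      by (simp add: mval_closed w geval_in add_closed)
  qed
next
  case (GMul s t)
  then obtain u v where w: "w = u @ v" "u \<in> mons s" "v \<in> mons t"
    by auto
  then have ne: "u \<noteq> []" "v \<noteq> []"
    using Nil_not_in_mons by blast+
  have "le S (mul S (mval S \<sigma> u) (mval S \<sigma> v)) (mul S (geval S \<sigma> s) (mval S \<sigma> v))"
    by (rule mul_mono_right[OF GMul.IH(1)[OF w(2)]]) (simp_all add: mval_closed ne geval_in)
  moreover have "le S (mul S (geval S \<sigma> s) (mval S \<sigma> v)) (mul S (geval S \<sigma> s) (geval S \<sigma> t))"
    by (rule mul_mono_left[OF GMul.IH(2)[OF w(3)]]) (simp_all add: mval_closed ne geval_in)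
  ultimately have "le S (mul S (mval S \<sigma> u) (mval S \<sigma> v)) (mul S (geval S \<sigma> s) (geval S \<sigma> t))"
    by (rule le_trans) (simp_all add: mval_closed ne geval_in mul_closed)
  then show ?case
    by (simp add: w(1) mval_append ne)
qed

text \<open>
  The factor \<open>p\<close> makes the induction go through a product, where the other factor joins it.
\<close>

lemma mul_geval_le:
  assumes "p \<in> carrier S" "z \<in> carrier S"
    "\<And>w. w \<in> mons t \<Longrightarrow> le S (mul S p (mval S \<sigma> w)) z"
  shows "le S (mul S p (geval S \<sigma> t)) z"
  using assms
proof (induction t arbitrary: p)
  case (GVar x)
  then show ?case by simp
next
  case (GAdd s t)
  have "le S (add S (mul S p (geval S \<sigma> s)) (mul S p (geval S \<sigma> t))) z"
    by (rule add_le) (use GAdd in \<open>simp_all add: geval_in mul_closed\<close>)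
  then show ?case
    using GAdd by (simp add: distrib_left geval_in)
next
  case (GMul s t)
  have "le S (mul S (mul S p (geval S \<sigma> t)) (mval S \<sigma> u)) z" if u: "u \<in> mons s" for u
  proof -
    have u': "mval S \<sigma> u \<in> carrier S"
      using u Nil_not_in_mons by (metis mval_closed)
    have "le S (mul S (mul S p (mval S \<sigma> u)) (geval S \<sigma> t)) z"
    proof (rule GMul.IH(2))
      fix v assume v: "v \<in> mons t"
      then have v': "mval S \<sigma> v \<in> carrier S"
        using Nil_not_in_mons by (metis mval_closed)
      have "mval S \<sigma> (u @ v) = mul S (mval S \<sigma> u) (mval S \<sigma> v)"
        using u v Nil_not_in_mons by (metis mval_append)
      then show "le S (mul S (mul S p (mval S \<sigma> u)) (mval S \<sigma> v)) z"
        using GMul.prems(3)[of "u @ v"] u v u' v' GMul.prems(1) by (auto simp: mul_assoc)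
    qed (use u' GMul.prems in \<open>simp_all add: mul_closed\<close>)
    then show ?thesis
      using GMul.prems(1) u' geval_in[of t] by (simp add: mul_ac mul_closed)
  qed
  then have "le S (mul S (mul S p (geval S \<sigma> t)) (geval S \<sigma> s)) z"
    using GMul.prems by (intro GMul.IH(1)) (simp_all add: mul_closed geval_in)
  then show ?case
    using GMul.prems(1) geval_in[of s] geval_in[of t] by (simp add: mul_ac mul_closed)
qed

lemma geval_le:
  assumes "z \<in> carrier S" "\<And>w. w \<in> mons t \<Longrightarrow> le S (mval S \<sigma> w) z"
  shows "le S (geval S \<sigma> t) z"
  using assms
proof (induction t)
  case (GVar x)
  then show ?case by simp
next
  case (GAdd s t)
  then show ?case
    by (auto intro!: add_le geval_in)
next
  case (GMul s t)
  have "le S (mul S (geval S \<sigma> t) (mval S \<sigma> u)) z" if u: "u \<in> mons s" for u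
  proof -
    have u': "mval S \<sigma> u \<in> carrier S"
      using u Nil_not_in_mons by (metis mval_closed)
    have "le S (mul S (mval S \<sigma> u) (geval S \<sigma> t)) z"
    proof (rule mul_geval_le)
      fix v assume v: "v \<in> mons t"
      have "mval S \<sigma> (u @ v) = mul S (mval S \<sigma> u) (mval S \<sigma> v)"
        using u v Nil_not_in_mons by (metis mval_append)
      then show "le S (mul S (mval S \<sigma> u) (mval S \<sigma> v)) z"
        using GMul.prems(2)[of "u @ v"] u v by auto
    qed (use u' GMul.prems in simp_all)
    then show ?thesis
      using u' geval_in[of t] by (simp add: mul_comm)
  qed
  then have "le S (mul S (geval S \<sigma> t) (geval S \<sigma> s)) z"
    using GMul.prems by (intro mul_geval_le) (simp_all add: geval_in)
  then show ?case
    using geval_in[of s] geval_in[of t] by (simp add: mul_comm)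
qed

end

end

section \<open>Identities of the semiring of the word \<open>ab\<close>\<close>

lemma carrier_Sc[simp]: "carrier Sc_ab = UNIV"
  by (simp add: Sc_ab_def)

lemma add_Sc[simp]: "add Sc_ab u v = (if u = v then u else El_inf)"
  by (simp add: Sc_ab_def)

lemma mul_Sc[simp]: "mul Sc_ab u v = (if {u, v} = {El_a, El_b} then El_ab else El_inf)"
  by (auto simp: Sc_ab_def doubleton_eq_iff)

interpretation Sc: comm_ai_semiring Sc_ab
  using ai_semiring_Sc_ab by (intro comm_ai_semiring.intro comm_ai_semiring_axioms.intro)
    (auto simp: insert_commute)

lemma le_Sc: "c \<noteq> El_inf \<Longrightarrow> le Sc_ab x c \<longleftrightarrow> x = c"
  by (auto simp: le_def)

text \<open>
  The finite elements of \<open>S\<^sub>c(ab)\<close> are minimal in the order, so a term has a finite value only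
  if all its monomials have this value.
\<close>

lemma geval_Sc_eq_iff:
  assumes "c \<noteq> El_inf"
  shows "geval Sc_ab \<tau> t = c \<longleftrightarrow> (\<forall>w\<in>mons t. mval Sc_ab \<tau> w = c)"
proof
  assume "geval Sc_ab \<tau> t = c"
  then show "\<forall>w\<in>mons t. mval Sc_ab \<tau> w = c"
    using Sc.mval_le_geval[of \<tau> _ t] le_Sc[OF assms] by auto
next
  assume "\<forall>w\<in>mons t. mval Sc_ab \<tau> w = c"
  then have "le Sc_ab (geval Sc_ab \<tau> t) c"
    by (intro Sc.geval_le) (auto simp: le_Sc[OF assms])
  then show "geval Sc_ab \<tau> t = c"
    by (simp add: le_Sc[OF assms])
qed

lemma mval_Sc_eq_ab_iff:
  "mval Sc_ab \<tau> (x # w) = El_ab \<longleftrightarrow>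
    (w = [] \<and> \<tau> x = El_ab) \<or> (\<exists>y. w = [y] \<and> {\<tau> x, \<tau> y} = {El_a, El_b})"
proof (cases w)
  case (Cons y v)
  then show ?thesis by (cases v) (auto simp: doubleton_eq_iff)
qed auto

lemma mval_Sc_cases:
  assumes "mval Sc_ab \<tau> w = c" "c \<noteq> El_inf" "w \<noteq> []"
  obtains (single) x where "w = [x]" "\<tau> x = c"
  | (pair) x y where "w = [x, y]" "{\<tau> x, \<tau> y} = {El_a, El_b}" "c = El_ab"
proof (cases "c = El_ab")
  case True
  then show thesis using assms that by (cases w) (auto simp: mval_Sc_eq_ab_iff)
next
  case False
  then show thesis using assms that by (cases "(Sc_ab, \<tau>, w)" rule: mval.cases) (auto split: if_splits)
qed

text \<open>
  An assignment with finite value \<open>ab\<close> is a proper 2-colouring of the graph of the monomials of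
  length two. The value of a variable that is a monomial by itself can be changed to \<open>\<infinity>\<close>, which
  shows that the other side of an identity has the same monomial; the monomials of length two
  are determined only up to the 2-colourings.
\<close>

lemma Sc_law_monomial:
  assumes law: "law Sc_ab s t" and fin: "geval Sc_ab \<tau> t = c" "c \<noteq> El_inf" and w: "w \<in> mons s"
  obtains (single) x where "w = [x]" "w \<in> mons t" "\<tau> x = c"
  | (pair) x y where "w = [x, y]" "{\<tau> x, \<tau> y} = {El_a, El_b}" "c = El_ab"
proof -
  have law: "geval Sc_ab \<rho> s = geval Sc_ab \<rho> t" for \<rho>
    using law by (simp add: law_def)
  have "mval Sc_ab \<tau> w = c"
    using law[of \<tau>] fin w by (auto simp: geval_Sc_eq_iff)
  moreover note fin(2)
  moreover have "w \<noteq> []"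
    using w Nil_not_in_mons by blast
  ultimately show thesis
  proof (cases rule: mval_Sc_cases)
    case (single x)
    define \<tau>' where "\<tau>' = \<tau>(x := El_inf)"
    have "geval Sc_ab \<tau>' s \<noteq> c"
    proof -
      have "mval Sc_ab \<tau>' w \<noteq> c"
        using single(1) fin(2) by (simp add: \<tau>'_def)
      then show ?thesis
        using w geval_Sc_eq_iff[OF fin(2)] by blast
    qed
    then obtain w' where w': "w' \<in> mons t" "mval Sc_ab \<tau>' w' \<noteq> c"
      using law fin(2) by (auto simp: geval_Sc_eq_iff)
    have "mval Sc_ab \<tau> w' = c"
      using w'(1) fin by (auto simp: geval_Sc_eq_iff)
    moreover note fin(2)
    moreover have "w' \<noteq> []"
      using w'(1) Nil_not_in_mons by blast
    ultimately have "w' = [x]"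
    proof (cases rule: mval_Sc_cases)
      case (single y)
      then show ?thesis using w'(2) by (auto simp: \<tau>'_def split: if_splits)
    next
      case (pair y z)
      then have "x \<noteq> y" "x \<noteq> z"
        using \<open>\<tau> x = c\<close> by (auto simp: doubleton_eq_iff)
      then show ?thesis using w'(2) pair by (simp add: \<tau>'_def)
    qed
    then show thesis using that(1) single w'(1) by simp
  qed (use that in auto)
qed

text \<open>
  The path law adds the edge between the end points of a path with three edges. Its closure
  operator turns a connected bipartite graph into the complete bipartite graph with the same
  2-colouring.
\<close>

definition path_law :: "'a alg \<Rightarrow> bool" where
  "path_law S \<longleftrightarrow> (\<forall>p\<in>carrier S. \<forall>q\<in>carrier S. \<forall>r\<in>carrier S. \<forall>u\<in>carrier S.
     le S (mul S p u) (add S (add S (mul S p q) (mul S q r)) (mul S r u)))"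

text \<open>
  If \<open>w = xy\<close> is a monomial of \<open>v\<close> but not of \<open>u\<close>, then the 2-colouring \<open>\<tau>\<close> of the variables
  folds \<open>u\<close> onto a path with three edges whose end points are the images of \<open>x\<close> and \<open>y\<close>: the
  other variables with the colour of \<open>x\<close> or \<open>y\<close> go to the inner vertices. The identity then adds
  the edge between the end points, which is the path law.
\<close>

lemma law_fails_path_law:
  assumes S: "comm_ai_semiring S" "\<not> path_law S" "law S u v"
    and Sc: "law Sc_ab u v" "geval Sc_ab \<tau> u \<noteq> El_inf" and w: "w \<in> mons v"
  shows "w \<in> mons u \<or> (\<exists>x y. w = [x, y] \<and> [y, x] \<in> mons u)"
proof (rule ccontr)
  assume not: "\<not> ?thesis"
  interpret comm_ai_semiring S by fact
  have "law Sc_ab v u"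
    using Sc(1) by (simp add: law_sym)
  then obtain x y where w_eq: "w = [x, y]" and xy: "{\<tau> x, \<tau> y} = {El_a, El_b}"
    and ab: "geval Sc_ab \<tau> u = El_ab"
    by (rule Sc_law_monomial[OF _ refl Sc(2) w]) (use not in auto)
  have "le S (mul S p q) (add S (add S (mul S p p2) (mul S p2 p3)) (mul S p3 q))"
    if p: "p \<in> carrier S" "q \<in> carrier S" "p2 \<in> carrier S" "p3 \<in> carrier S" for p q p2 p3
  proof -
    define P where "P = add S (add S (mul S p p2) (mul S p2 p3)) (mul S p3 q)"
    have in_S[simp]: "p \<in> carrier S" "q \<in> carrier S" "p2 \<in> carrier S" "p3 \<in> carrier S"
        "mul S p p2 \<in> carrier S" "mul S p2 p3 \<in> carrier S" "mul S p3 q \<in> carrier S" "P \<in> carrier S"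
      using p by (simp_all add: P_def mul_closed add_closed)
    have P: "le S (mul S p p2) P" "le S (mul S p2 p3) P" "le S (mul S p3 q) P"
    proof -
      show "le S (mul S p p2) P"
        unfolding P_def by (rule le_trans[OF le_add1 le_add1]) (simp_all add: add_closed)
      show "le S (mul S p2 p3) P"
        unfolding P_def by (rule le_trans[OF le_add2 le_add1]) (simp_all add: add_closed)
      show "le S (mul S p3 q) P"
        unfolding P_def by (rule le_add2) (simp_all add: add_closed)
    qed
    \<comment> \<open>variables that are monomials by themselves become the first edge of the path\<close>
    define \<rho> where "\<rho> z = (if z = x then p else if z = y then q else if \<tau> z = \<tau> x then p3
        else if \<tau> z = \<tau> y then p2 else mul S p p2)" for z
    have \<rho>: "\<rho> z \<in> carrier S" for z
      by (simp add: \<rho>_def)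
    have "le S (geval S \<rho> u) P"
    proof (rule geval_le[OF \<rho>])
      fix w' assume w': "w' \<in> mons u"
      then have "mval Sc_ab \<tau> w' = El_ab" "El_ab \<noteq> El_inf" "w' \<noteq> []"
        using ab Nil_not_in_mons by (auto simp: geval_Sc_eq_iff)
      then show "le S (mval S \<rho> w') P"
      proof (cases rule: mval_Sc_cases)
        case (single z)
        then have "\<rho> z = mul S p p2"
          using xy by (auto simp: \<rho>_def doubleton_eq_iff)
        then show ?thesis using single P by simp
      next
        case (pair z z')
        have "\<not> (z = x \<and> z' = y)" "\<not> (z = y \<and> z' = x)"
          using not w' pair w_eq by auto
        moreover have "\<tau> z = \<tau> x \<and> \<tau> z' = \<tau> y \<or> \<tau> z = \<tau> y \<and> \<tau> z' = \<tau> x" "\<tau> x \<noteq> \<tau> y"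
          using pair xy by (auto simp: doubleton_eq_iff)
        ultimately show ?thesis
          using P pair(1) mul_comm[of p p2] mul_comm[of p2 p3] mul_comm[of p3 q]
          by (auto simp: \<rho>_def)
      qed
    qed simp
    moreover have "range \<rho> \<subseteq> carrier S"
      using \<rho> by blast
    then have "geval S \<rho> u = geval S \<rho> v"
      using S(3) unfolding law_def by blast
    moreover have "le S (mval S \<rho> w) (geval S \<rho> v)"
      using w by (rule mval_le_geval[OF \<rho>])
    moreover have "mval S \<rho> w = mul S p q"
      using xy by (auto simp: w_eq \<rho>_def doubleton_eq_iff)
    ultimately show ?thesis
      using le_trans[of "mul S p q" "geval S \<rho> u" P] geval_in[of \<rho> u, OF \<rho>]
      by (simp add: P_def[symmetric] mul_closed)
  qed
  then have "path_law S"
    by (simp add: path_law_def)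
  with S(2) show False ..
qed

definition edge_below :: "'a alg \<Rightarrow> ('v \<Rightarrow> 'a) \<Rightarrow> 'a \<Rightarrow> 'v \<Rightarrow> 'v \<Rightarrow> bool" where
  "edge_below S \<sigma> e x y \<longleftrightarrow> le S (mul S (\<sigma> x) (\<sigma> y)) e"

context comm_ai_semiring
begin

context
  fixes \<sigma> :: "'v \<Rightarrow> 'a" and e :: 'a
  assumes \<sigma>: "\<sigma> x \<in> carrier S"
begin

lemma edge_below_sym: "edge_below S \<sigma> e x y \<Longrightarrow> edge_below S \<sigma> e y x"
  using mul_comm[OF \<sigma> \<sigma>, of x y] by (simp add: edge_below_def)

lemma edge_below_walk:
  assumes "path_law S" "e \<in> carrier S"
    "edge_below S \<sigma> e z1 z2" "edge_below S \<sigma> e z2 z3" "edge_below S \<sigma> e z3 z4"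
  shows "edge_below S \<sigma> e z1 z4"
proof -
  let ?P = "add S (add S (mul S (\<sigma> z1) (\<sigma> z2)) (mul S (\<sigma> z2) (\<sigma> z3))) (mul S (\<sigma> z3) (\<sigma> z4))"
  have "le S (mul S (\<sigma> z1) (\<sigma> z4)) ?P"
    using assms(1) \<sigma> unfolding path_law_def by blast
  moreover have "le S ?P e"
    using assms unfolding edge_below_def by (intro add_le) (simp_all add: \<sigma> mul_closed add_closed)
  ultimately show ?thesis
    unfolding edge_below_def by (rule le_trans) (simp_all add: \<sigma> assms(2) mul_closed add_closed)
qed

end

end

text \<open>
  The relation \<open>B x y\<close>, that the edge \<open>xy\<close> lies below the value of \<open>t\<close>, is closed under walks of
  length three. If it failed for an edge \<open>xy\<close> of \<open>s\<close>, then exchanging the two colours at the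
  variables that a walk from \<open>x\<close> reaches with the right parity would leave \<open>t\<close> properly coloured
  and give \<open>x\<close> and \<open>y\<close> the same colour.
\<close>

lemma le_geval_if_Sc_finite:
  assumes T: "comm_ai_semiring T" "path_law T" and \<sigma>: "\<And>x. \<sigma> x \<in> carrier T"
    and Sc: "law Sc_ab s t" "geval Sc_ab \<tau> t \<noteq> El_inf" and w: "w \<in> mons s"
  shows "le T (mval T \<sigma> w) (geval T \<sigma> t)"
proof -
  interpret comm_ai_semiring T by fact
  from Sc(1) refl Sc(2) w show ?thesis
  proof (cases rule: Sc_law_monomial)
    case (single x)
    then show ?thesis by (intro mval_le_geval \<sigma>)
  next
    case (pair x y)
    define e where "e = geval T \<sigma> t"
    have e: "e \<in> carrier T"
      unfolding e_def by (rule geval_in[OF \<sigma>])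
    define B where "B = edge_below T \<sigma> e"
    note B_sym = edge_below_sym[of \<sigma> e, OF \<sigma>, folded B_def]
    note B_walk = edge_below_walk[of \<sigma> e, OF \<sigma> T(2) e, folded B_def]
    have edge: "B z z'" if "[z, z'] \<in> mons t" for z z'
      using mval_le_geval[OF \<sigma> that] by (simp add: B_def edge_below_def e_def)
    have "B x y"
    proof (rule ccontr)
      assume not: "\<not> B x y"
      \<comment> \<open>the colour class of \<open>x\<close> is reached by even walks, the colour class of \<open>y\<close> by odd ones\<close>
      define F where "F = {z. \<tau> z = \<tau> x \<and> (z = x \<or> (\<exists>p. B x p \<and> B p z))} \<union> {z. \<tau> z = \<tau> y \<and> B x z}"
      define sw where "sw c = (if c = El_a then El_b else El_a)" for c
      define \<tau>' where "\<tau>' z = (if z \<in> F then sw (\<tau> z) else \<tau> z)" for z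
      have xF: "x \<in> F" and yF: "y \<notin> F"
        using pair(2) not by (auto simp: F_def doubleton_eq_iff)
      have F_colour: "\<tau> z \<in> {El_a, El_b}" if "z \<in> F" for z
        using that pair(2) by (auto simp: F_def doubleton_eq_iff)
      have F_edge: "z' \<in> F" if z: "z \<in> F" and zz': "B z z'" "{\<tau> z, \<tau> z'} = {El_a, El_b}" for z z'
      proof -
        have other: "\<tau> z = \<tau> x \<Longrightarrow> \<tau> z' = \<tau> y" "\<tau> z = \<tau> y \<Longrightarrow> \<tau> z' = \<tau> x" and xy: "\<tau> x \<noteq> \<tau> y"
          using zz'(2) pair(2) by (auto simp: doubleton_eq_iff)
        consider "\<tau> z = \<tau> x" "z = x" | p where "\<tau> z = \<tau> x" "B x p" "B p z" | "\<tau> z = \<tau> y" "B x z"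
          using z unfolding F_def by blast
        then show ?thesis
        proof cases
          case 1
          then show ?thesis using other zz'(1) by (auto simp: F_def)
        next
          case 2
          then show ?thesis using other B_walk[OF 2(2,3) zz'(1)] by (auto simp: F_def)
        next
          case 3
          then show ?thesis using other zz'(1) by (auto simp: F_def)
        qed
      qed
      have "mval Sc_ab \<tau>' w' = El_ab" if w': "w' \<in> mons t" for w'
      proof -
        have "mval Sc_ab \<tau> w' = El_ab" "El_ab \<noteq> El_inf" "w' \<noteq> []"
          using w' pair(3) Nil_not_in_mons by (auto simp: geval_Sc_eq_iff)
        then show ?thesis
        proof (cases rule: mval_Sc_cases)
          case (single z)
          then have "z \<notin> F"
            using F_colour by fastforce
          then show ?thesis using single by (simp add: \<tau>'_def)
        next
          case (pair z z')
          have "B z z'" "B z' z"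
            using edge w' pair(1) B_sym by auto
          then have "z \<in> F \<longleftrightarrow> z' \<in> F"
            using F_edge[of z z'] F_edge[of z' z] pair(2) by (auto simp: insert_commute)
          then show ?thesis
            using pair by (auto simp: \<tau>'_def sw_def doubleton_eq_iff)
        qed
      qed
      then have "geval Sc_ab \<tau>' t = El_ab"
        by (auto simp: geval_Sc_eq_iff)
      then have "geval Sc_ab \<tau>' s = El_ab"
        using Sc(1) by (simp add: law_def)
      then have "mval Sc_ab \<tau>' w = El_ab"
        using w by (auto simp: geval_Sc_eq_iff)
      then have "{\<tau>' x, \<tau>' y} = {El_a, El_b}"
        using pair(1) by (simp add: mval_Sc_eq_ab_iff split: if_splits)
      then show False
        using xF yF pair(2) by (auto simp: \<tau>'_def sw_def doubleton_eq_iff)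
    qed
    then show ?thesis
      using pair(1) by (simp add: B_def edge_below_def e_def)
  qed
qed

section \<open>Equational bases of the two least members\<close>

text \<open>
  Beyond the path law, the identities say that squares and mixed sums \<open>x + xy\<close> are products of three
  elements, and that adding anything to such a product amounts to multiplying by it. Hence only
  the set of variables of a term matters when the term has no finite value in \<open>S\<^sub>c(ab)\<close>. The
  additional identity of \<open>Sc_model\<close> makes all these terms equal.
\<close>

locale M2_Sc_model = comm_ai_semiring +
  assumes path: "path_law S"
    and square: "x \<in> carrier S \<Longrightarrow> mul S x x = mul S (mul S x x) x"
    and cube_add: "x \<in> carrier S \<Longrightarrow> y \<in> carrier S \<Longrightarrow> z \<in> carrier S \<Longrightarrow> w \<in> carrier S \<Longrightarrow>
      add S (mul S (mul S x y) z) w = mul S (mul S (mul S x y) z) w"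
    and mixed: "x \<in> carrier S \<Longrightarrow> y \<in> carrier S \<Longrightarrow> add S x (mul S x y) = mul S (mul S x x) y"

locale Sc_model = M2_Sc_model +
  assumes squares_eq: "x \<in> carrier S \<Longrightarrow> y \<in> carrier S \<Longrightarrow> mul S x x = mul S y y"

definition law_comm :: "trm \<times> trm" where
  "law_comm = (Mul (Var 0) (Var 1), Mul (Var 1) (Var 0))"

definition law_path :: "trm \<times> trm" where
  "law_path = (let P = Add (Add (Mul (Var 0) (Var 1)) (Mul (Var 1) (Var 2))) (Mul (Var 2) (Var 3))
     in (Add (Mul (Var 0) (Var 3)) P, P))"

definition law_square :: "trm \<times> trm" where
  "law_square = (Mul (Var 0) (Var 0), Mul (Mul (Var 0) (Var 0)) (Var 0))"

definition law_cube_add :: "trm \<times> trm" where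
  "law_cube_add = (Add (Mul (Mul (Var 0) (Var 1)) (Var 2)) (Var 3),
     Mul (Mul (Mul (Var 0) (Var 1)) (Var 2)) (Var 3))"

definition law_mixed :: "trm \<times> trm" where
  "law_mixed = (Add (Var 0) (Mul (Var 0) (Var 1)), Mul (Mul (Var 0) (Var 0)) (Var 1))"

definition law_squares_eq :: "trm \<times> trm" where
  "law_squares_eq = (Mul (Var 0) (Var 0), Mul (Var 1) (Var 1))"

definition M2_Sc_basis :: "(trm \<times> trm) set" where
  "M2_Sc_basis = {law_comm, law_path, law_square, law_cube_add, law_mixed}"

definition Sc_basis :: "(trm \<times> trm) set" where
  "Sc_basis = insert law_squares_eq M2_Sc_basis"

definition assign4 :: "'a \<Rightarrow> 'a \<Rightarrow> 'a \<Rightarrow> 'a \<Rightarrow> nat \<Rightarrow> 'a" where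
  "assign4 p q r u n = (if n = 0 then p else if n = 1 then q else if n = 2 then r else u)"

lemma assign4_simps[simp]: "assign4 p q r u 0 = p" "assign4 p q r u (Suc 0) = q"
  "assign4 p q r u 2 = r" "assign4 p q r u 3 = u"
  by (simp_all add: assign4_def)

lemma satisfies_assign4:
  assumes "satisfies S e" "p \<in> carrier S" "q \<in> carrier S" "r \<in> carrier S" "u \<in> carrier S"
  shows "eval S (assign4 p q r u) (fst e) = eval S (assign4 p q r u) (snd e)"
proof -
  have "range (assign4 p q r u) \<subseteq> carrier S"
    using assms by (auto simp: assign4_def)
  then show ?thesis
    using assms(1) unfolding satisfies_def by blast
qed

lemma path_law_iff: "path_law S \<longleftrightarrow> satisfies S law_path"
proof
  assume S: "satisfies S law_path"
  show "path_law S"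
    unfolding path_law_def
  proof (intro ballI)
    fix p q r u assume "p \<in> carrier S" "q \<in> carrier S" "r \<in> carrier S" "u \<in> carrier S"
    from satisfies_assign4[OF S this]
    show "le S (mul S p u) (add S (add S (mul S p q) (mul S q r)) (mul S r u))"
      by (simp add: law_path_def Let_def le_def)
  qed
next
  assume S: "path_law S"
  show "satisfies S law_path"
    unfolding satisfies_def
  proof (intro allI impI)
    fix \<sigma> :: "nat \<Rightarrow> 'a" assume "range \<sigma> \<subseteq> carrier S"
    then have "\<sigma> n \<in> carrier S" for n
      by blast
    with S have "le S (mul S (\<sigma> 0) (\<sigma> 3))
        (add S (add S (mul S (\<sigma> 0) (\<sigma> 1)) (mul S (\<sigma> 1) (\<sigma> 2))) (mul S (\<sigma> 2) (\<sigma> 3)))"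
      unfolding path_law_def by blast
    then show "eval S \<sigma> (fst law_path) = eval S \<sigma> (snd law_path)"
      by (simp add: law_path_def Let_def le_def)
  qed
qed

lemma comm_ai_semiring_iff: "comm_ai_semiring S \<longleftrightarrow> ai_semiring S \<and> satisfies S law_comm"
proof
  assume "comm_ai_semiring S"
  then interpret comm_ai_semiring S .
  show "ai_semiring S \<and> satisfies S law_comm"
    unfolding satisfies_def law_comm_def
    using ai_semiring_axioms by (simp add: image_subset_iff mul_comm)
next
  assume S: "ai_semiring S \<and> satisfies S law_comm"
  show "comm_ai_semiring S"
  proof (intro comm_ai_semiring.intro comm_ai_semiring_axioms.intro)
    fix x y assume xy: "x \<in> carrier S" "y \<in> carrier S"
    show "mul S x y = mul S y x"
      using satisfies_assign4[of S law_comm x y x x] S xy by (simp add: law_comm_def)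
  qed (use S in simp)
qed

lemma M2_Sc_model_iff: "M2_Sc_model S \<longleftrightarrow> ai_semiring S \<and> (\<forall>e\<in>M2_Sc_basis. satisfies S e)"
proof
  assume "M2_Sc_model S"
  then interpret M2_Sc_model S .
  have "satisfies S law_square"
    unfolding satisfies_def law_square_def by (auto intro: square)
  moreover have "satisfies S law_cube_add"
    unfolding satisfies_def law_cube_add_def by (auto intro!: cube_add)
  moreover have "satisfies S law_mixed"
    unfolding satisfies_def law_mixed_def by (auto intro!: mixed)
  ultimately show "ai_semiring S \<and> (\<forall>e\<in>M2_Sc_basis. satisfies S e)"
    using comm_ai_semiring_axioms path
    by (simp add: M2_Sc_basis_def comm_ai_semiring_iff path_law_iff)
next
  assume S: "ai_semiring S \<and> (\<forall>e\<in>M2_Sc_basis. satisfies S e)"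
  show "M2_Sc_model S"
  proof (intro M2_Sc_model.intro M2_Sc_model_axioms.intro)
    show "comm_ai_semiring S" "path_law S"
      using S by (simp_all add: M2_Sc_basis_def comm_ai_semiring_iff path_law_iff)
    fix x y z w assume x: "x \<in> carrier S"
    show "mul S x x = mul S (mul S x x) x"
      using satisfies_assign4[of S law_square x x x x] S x
      by (simp add: M2_Sc_basis_def law_square_def)
    assume y: "y \<in> carrier S"
    show "add S x (mul S x y) = mul S (mul S x x) y"
      using satisfies_assign4[of S law_mixed x y x x] S x y
      by (simp add: M2_Sc_basis_def law_mixed_def)
    assume "z \<in> carrier S" "w \<in> carrier S"
    then show "add S (mul S (mul S x y) z) w = mul S (mul S (mul S x y) z) w"
      using satisfies_assign4[of S law_cube_add x y z w] S x y
      by (simp add: M2_Sc_basis_def law_cube_add_def)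
  qed
qed

lemma Sc_model_iff: "Sc_model S \<longleftrightarrow> ai_semiring S \<and> (\<forall>e\<in>Sc_basis. satisfies S e)"
proof
  assume "Sc_model S"
  then interpret Sc_model S .
  have "satisfies S law_squares_eq"
    unfolding satisfies_def law_squares_eq_def by (auto intro!: squares_eq)
  then show "ai_semiring S \<and> (\<forall>e\<in>Sc_basis. satisfies S e)"
    using M2_Sc_model_axioms by (simp add: Sc_basis_def M2_Sc_model_iff)
next
  assume S: "ai_semiring S \<and> (\<forall>e\<in>Sc_basis. satisfies S e)"
  show "Sc_model S"
  proof (intro Sc_model.intro Sc_model_axioms.intro)
    show "M2_Sc_model S"
      using S by (simp add: M2_Sc_model_iff Sc_basis_def)
    fix x y assume "x \<in> carrier S" "y \<in> carrier S"
    then show "mul S x x = mul S y y"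
      using satisfies_assign4[of S law_squares_eq x y x x] S
      by (simp add: Sc_basis_def law_squares_eq_def)
  qed
qed

lemma finite_bases: "finite M2_Sc_basis" "finite Sc_basis"
  by (simp_all add: M2_Sc_basis_def Sc_basis_def)

text \<open>
  The elements that take over the role of \<open>\<infinity>\<close>.
\<close>

definition cubes :: "'a alg \<Rightarrow> 'a set" where
  "cubes S = {mul S (mul S x y) z | x y z. x \<in> carrier S \<and> y \<in> carrier S \<and> z \<in> carrier S}"

context M2_Sc_model
begin

lemma cubes_closed: "m \<in> cubes S \<Longrightarrow> m \<in> carrier S"
  by (auto simp: cubes_def mul_closed)

lemma cubesI: "x \<in> carrier S \<Longrightarrow> y \<in> carrier S \<Longrightarrow> z \<in> carrier S \<Longrightarrow> mul S (mul S x y) z \<in> cubes S"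
  by (auto simp: cubes_def)

lemma cubes_add: "m \<in> cubes S \<Longrightarrow> q \<in> carrier S \<Longrightarrow> add S m q = mul S m q"
  by (auto simp: cubes_def cube_add)

lemma cubes_mul:
  assumes "m \<in> cubes S" "q \<in> carrier S"
  shows "mul S m q \<in> cubes S"
proof -
  obtain x y z where xyz: "m = mul S (mul S x y) z" "x \<in> carrier S" "y \<in> carrier S" "z \<in> carrier S"
    using assms(1) by (auto simp: cubes_def)
  then have "mul S m q = mul S (mul S x y) (mul S z q)"
    using assms(2) by (simp add: mul_assoc mul_closed)
  then show ?thesis
    using xyz assms(2) by (simp add: cubesI mul_closed)
qed

context
  fixes \<sigma> :: "'v \<Rightarrow> 'a"
  assumes \<sigma>: "\<sigma> x \<in> carrier S"
begin

text \<open>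
  If no product of three elements lies below the value of \<open>t\<close>, then \<open>t\<close> consists of variables
  and of edges between other variables, and no closed walk of odd length exists, so that
  the parity of walks from a representative of each component is a proper 2-colouring.
\<close>

lemma cube_below_if_Sc_infinite:
  assumes inf: "\<And>\<tau>. geval Sc_ab \<tau> t = El_inf"
  shows "\<exists>m\<in>cubes S. le S m (geval S \<sigma> t)"
proof (rule ccontr)
  define e where "e = geval S \<sigma> t"
  have e: "e \<in> carrier S"
    unfolding e_def by (rule geval_in[OF \<sigma>])
  assume "\<not> ?thesis"
  then have no_cube: "\<not> le S (mul S (mul S x y) z) e"
    if "x \<in> carrier S" "y \<in> carrier S" "z \<in> carrier S" for x y z
    using that cubesI by (auto simp: e_def)
  have below: "le S (mval S \<sigma> w) e" if "w \<in> mons t" for w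
    unfolding e_def using that by (rule mval_le_geval[OF \<sigma>])
  have small: "(\<exists>x. w = [x]) \<or> (\<exists>x y. w = [x, y])" if w: "w \<in> mons t" for w
  proof (rule ccontr)
    assume "\<not> ?thesis"
    moreover have "w \<noteq> []"
      using w Nil_not_in_mons by blast
    ultimately obtain x y z v where "w = x # y # z # v"
      by (metis list.exhaust)
    then have "mval S \<sigma> w = mul S (mul S (\<sigma> x) (\<sigma> y)) (mval S \<sigma> (z # v))"
      using mval_closed[OF \<sigma>, of "z # v"] by (simp add: \<sigma> mul_assoc)
    then show False
      using no_cube[OF \<sigma> \<sigma>, of "mval S \<sigma> (z # v)"] below[OF w] mval_closed[OF \<sigma>, of "z # v"] by simp
  qed

  define B where "B = edge_below S \<sigma> e"
  note B_sym = edge_below_sym[of \<sigma> e, OF \<sigma>, folded B_def]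
  note B_walk = edge_below_walk[of \<sigma> e, OF \<sigma> path e, folded B_def]
  have edge: "B z z'" if "[z, z'] \<in> mons t" for z z'
    using below[OF that] by (simp add: B_def edge_below_def)
  have no_loop: "\<not> B z z" for z
    using no_cube[OF \<sigma> \<sigma> \<sigma>, of z z z] square[OF \<sigma>, of z] by (simp add: B_def edge_below_def)
  have not_mixed: "\<not> B z z'" if "[z] \<in> mons t" for z z'
  proof
    assume "B z z'"
    then have "le S (add S (\<sigma> z) (mul S (\<sigma> z) (\<sigma> z'))) e"
      using below[OF that] e by (intro add_le) (simp_all add: B_def edge_below_def \<sigma> mul_closed)
    then show False
      using no_cube[OF \<sigma> \<sigma> \<sigma>, of z z z'] by (simp add: mixed \<sigma>)
  qed

  define even_walk where "even_walk z z' \<longleftrightarrow> (\<exists>p. B z p \<and> B p z')" for z z'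
  define comp where "comp z = {z'. B z z' \<or> even_walk z z'}" for z
  \<comment> \<open>\<open>comp\<close> is constant on components, so its choice singles out one vertex per component\<close>
  define rep where "rep z = (SOME r. r \<in> comp z)" for z
  have comp_sub: "comp z \<subseteq> comp z'" if "B z z'" for z z'
    using that B_sym[OF that] B_walk unfolding comp_def even_walk_def by blast
  define \<tau> where "\<tau> z = (if [z] \<in> mons t then El_ab else if even_walk (rep z) z then El_a else El_b)"
    for z
  have proper: "{\<tau> z, \<tau> z'} = {El_a, El_b}" if B: "B z z'" for z z'
  proof -
    have "comp z = comp z'"
      using comp_sub[OF B] comp_sub[OF B_sym[OF B]] by blast
    then have r: "rep z' = rep z"
      by (simp add: rep_def)
    have "\<exists>r. r \<in> comp z"
      using B by (auto simp: comp_def)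
    then have "rep z \<in> comp z"
      unfolding rep_def by (rule someI_ex)
    then have r_z: "B z (rep z) \<or> even_walk z (rep z)"
      by (simp add: comp_def)
    have "even_walk (rep z) z \<longleftrightarrow> \<not> even_walk (rep z) z'"
    proof
      assume "even_walk (rep z) z"
      then have "B (rep z) z'"
        using B B_walk unfolding even_walk_def by blast
      then show "\<not> even_walk (rep z) z'"
        using B_sym[of "rep z" z'] B_walk no_loop[of z'] unfolding even_walk_def by blast
    next
      assume not: "\<not> even_walk (rep z) z'"
      have "\<not> B z (rep z)"
        using not B B_sym[of z "rep z"] unfolding even_walk_def by blast
      with r_z show "even_walk (rep z) z"
        unfolding even_walk_def using B_sym by blast
    qed
    moreover have "[z] \<notin> mons t" "[z'] \<notin> mons t"
      using not_mixed B B_sym[OF B] by blast+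
    ultimately show ?thesis
      by (auto simp: \<tau>_def r)
  qed
  have "mval Sc_ab \<tau> w = El_ab" if w: "w \<in> mons t" for w
    using small[OF w]
  proof (elim disjE exE)
    fix x assume "w = [x]"
    then show ?thesis using w by (simp add: \<tau>_def)
  next
    fix x y assume "w = [x, y]"
    then show ?thesis using w proper[OF edge, of x y] by simp
  qed
  then have "geval Sc_ab \<tau> t = El_ab"
    by (simp add: geval_Sc_eq_iff)
  then show False
    using inf[of \<tau>] by simp
qed

lemma mval_factor:
  assumes "x \<in> set w"
  shows "mval S \<sigma> w = \<sigma> x \<or> (\<exists>q\<in>carrier S. mval S \<sigma> w = mul S (\<sigma> x) q)"
  using assms
proof (induction w)
  case (Cons y w)
  show ?case
  proof (cases w)
    case Nil
    then show ?thesis using Cons.prems by simp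
  next
    case (Cons z v)
    then have w: "mval S \<sigma> w \<in> carrier S" and yw: "mval S \<sigma> (y # w) = mul S (\<sigma> y) (mval S \<sigma> w)"
      using mval_closed[OF \<sigma>, of w] by simp_all
    show ?thesis
    proof (cases "x = y")
      case True
      then show ?thesis using w yw by blast
    next
      case False
      then consider "mval S \<sigma> w = \<sigma> x" | q where "q \<in> carrier S" "mval S \<sigma> w = mul S (\<sigma> x) q"
        using Cons.IH Cons.prems by auto
      then show ?thesis
      proof cases
        case 1
        then show ?thesis unfolding yw using mul_comm[OF \<sigma> \<sigma>, of y x] \<sigma>[of y] by auto
      next
        case 2
        then show ?thesis unfolding yw using mul_left_comm[OF \<sigma> \<sigma>, of q y x] mul_closed[OF \<sigma>, of q y] by auto
      qed
    qed
  qed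
qed simp

text \<open>
  Adding an element to a product of three elements multiplies it by that element. Hence a product
  of three elements below the value of \<open>t\<close> absorbs all variables of \<open>t\<close>, in any number.
\<close>

lemma mval_le_if_cube_below:
  assumes m: "m \<in> cubes S" "le S m (geval S \<sigma> t)" and w: "w \<noteq> []" "set w \<subseteq> set_gterm t"
  shows "le S (mval S \<sigma> w) (geval S \<sigma> t)"
proof -
  define e where "e = geval S \<sigma> t"
  have e: "e \<in> carrier S"
    unfolding e_def by (rule geval_in[OF \<sigma>])
  have var: "le S (\<sigma> x) e" if x: "x \<in> set_gterm t" for x
  proof -
    obtain v where v: "v \<in> mons t" "x \<in> set v"
      using x set_mons[of t] by blast
    have v': "mval S \<sigma> v \<in> carrier S"
      using v by (intro mval_closed[OF \<sigma>]) auto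
    have mx: "mul S m (\<sigma> x) \<in> cubes S" "add S m (\<sigma> x) = mul S m (\<sigma> x)"
      using m(1) \<sigma> by (simp_all add: cubes_mul cubes_add)
    have x_le: "le S (\<sigma> x) (mul S m (\<sigma> x))"
      using le_add2[of m "\<sigma> x"] mx(2) m(1) \<sigma> by (simp add: cubes_closed)
    have "le S (\<sigma> x) (mul S m (mval S \<sigma> v))"
      using mval_factor[OF v(2)]
    proof
      assume "mval S \<sigma> v = \<sigma> x"
      then show ?thesis using x_le by simp
    next
      assume "\<exists>q\<in>carrier S. mval S \<sigma> v = mul S (\<sigma> x) q"
      then obtain q where q: "q \<in> carrier S" "mval S \<sigma> v = mul S (\<sigma> x) q"
        by blast
      then have "mul S m (mval S \<sigma> v) = add S (mul S m (\<sigma> x)) q"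
        using mx(1) m(1) \<sigma> by (simp add: cubes_add mul_assoc cubes_closed)
      then show ?thesis
        using le_trans[OF x_le le_add1[of "mul S m (\<sigma> x)" q]] mx(1) q \<sigma>
        by (simp add: cubes_closed add_closed)
    qed
    moreover have "le S (mul S m (mval S \<sigma> v)) e"
      using add_le[OF m(2) mval_le_geval[OF \<sigma> v(1)]] m(1) v' e
      by (simp add: e_def cubes_add cubes_closed)
    ultimately show ?thesis
      by (rule le_trans) (simp_all add: \<sigma> e m(1) v' mul_closed cubes_closed)
  qed
  have "le S (mul S m (mval S \<sigma> w)) e"
    using w m(1) m(2)[folded e_def]
  proof (induction w arbitrary: m rule: list_nonempty_induct)
    case (single x)
    then show ?case
      using add_le[OF _ var, of m x] \<sigma> e by (simp add: cubes_add[symmetric] cubes_closed)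
  next
    case (cons x w)
    have "le S (mul S m (\<sigma> x)) e"
      using add_le[OF _ var, of m x] cons \<sigma> e by (simp add: cubes_add[symmetric] cubes_closed)
    then have "le S (mul S (mul S m (\<sigma> x)) (mval S \<sigma> w)) e"
      using cons by (intro cons.IH cubes_mul \<sigma>) auto
    moreover have "mval S \<sigma> (x # w) = mul S (\<sigma> x) (mval S \<sigma> w)"
      using cons.hyps(1) by (cases w) simp_all
    ultimately show ?case
      using mval_closed[OF \<sigma> cons.hyps(1)] cons.prems(2) \<sigma> by (simp add: mul_assoc cubes_closed)
  qed
  moreover have "le S (mval S \<sigma> w) (mul S m (mval S \<sigma> w))"
    using le_add2[of m "mval S \<sigma> w"] m(1) mval_closed[OF \<sigma> w(1)] by (simp add: cubes_closed cubes_add)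
  ultimately show ?thesis
    unfolding e_def[symmetric] using mval_closed[OF \<sigma> w(1)] e m(1)
    by (meson le_trans mul_closed cubes_closed)
qed

lemma geval_le_if_Sc_law:
  assumes "law Sc_ab s t" "set_gterm s = set_gterm t"
  shows "le S (geval S \<sigma> s) (geval S \<sigma> t)"
proof (rule geval_le[OF \<sigma>])
  fix w assume w: "w \<in> mons s"
  show "le S (mval S \<sigma> w) (geval S \<sigma> t)"
  proof (cases "\<exists>\<tau>. geval Sc_ab \<tau> t \<noteq> El_inf")
    case True
    then obtain \<tau> where "geval Sc_ab \<tau> t \<noteq> El_inf" ..
    from this w show ?thesis
      by (rule le_geval_if_Sc_finite[where \<sigma> = \<sigma>, OF comm_ai_semiring_axioms path \<sigma> assms(1)])
  next
    case False
    then have "\<exists>m\<in>cubes S. le S m (geval S \<sigma> t)"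
      by (intro cube_below_if_Sc_infinite) blast
    then obtain m where "m \<in> cubes S" "le S m (geval S \<sigma> t)"
      by blast
    moreover have "w \<noteq> []" "set w \<subseteq> set_gterm t"
      using w Nil_not_in_mons set_mons[of s] assms(2) by auto
    ultimately show ?thesis
      by (rule mval_le_if_cube_below)
  qed
qed (rule geval_in[OF \<sigma>])

end

lemma law_if_Sc_law_same_vars:
  fixes s t :: "'v gterm"
  assumes "law Sc_ab s t" "set_gterm s = set_gterm t"
  shows "law S s t"
  unfolding law_def
proof (intro allI impI)
  fix \<sigma> :: "'v \<Rightarrow> 'a" assume "range \<sigma> \<subseteq> carrier S"
  then have \<sigma>: "\<sigma> x \<in> carrier S" for x
    by blast
  show "geval S \<sigma> s = geval S \<sigma> t"
  proof (rule le_antisym)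
    show "le S (geval S \<sigma> s) (geval S \<sigma> t)"
      by (rule geval_le_if_Sc_law[where \<sigma> = \<sigma>, OF \<sigma> assms])
    show "le S (geval S \<sigma> t) (geval S \<sigma> s)"
      using assms by (intro geval_le_if_Sc_law[where \<sigma> = \<sigma>, OF \<sigma>]) (simp_all add: law_sym)
  qed (rule geval_in[where \<sigma> = \<sigma>, OF \<sigma>])+
qed

end

text \<open>
  A product of three elements is idempotent, so it equals the common value of all squares.
\<close>

lemma (in Sc_model) cube_top:
  assumes m: "m \<in> cubes S" and q: "q \<in> carrier S"
  shows "le S q m"
proof -
  have sq: "c = mul S q q" if c: "c \<in> cubes S" for c
  proof -
    have "c = mul S c c"
      using cubes_add[OF c cubes_closed[OF c]] add_idem[OF cubes_closed[OF c]] by simp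
    then show ?thesis
      using squares_eq[OF cubes_closed[OF c] q] by simp
  qed
  have "add S q m = mul S m q"
    using cubes_add[OF m q] add_comm[OF q cubes_closed[OF m]] by simp
  then show ?thesis
    using sq[OF m] sq[OF cubes_mul[OF m q]] by (simp add: le_def)
qed

lemma (in Sc_model) law_if_Sc_law:
  fixes s t :: "'v gterm"
  assumes "law Sc_ab s t"
  shows "law S s t"
  unfolding law_def
proof (intro allI impI)
  fix \<sigma> :: "'v \<Rightarrow> 'a" assume "range \<sigma> \<subseteq> carrier S"
  then have \<sigma>: "\<sigma> x \<in> carrier S" for x
    by blast
  have in_S: "geval S \<sigma> r \<in> carrier S" for r
    by (rule geval_in[where \<sigma> = \<sigma>, OF \<sigma>])
  have st: "law Sc_ab t s"
    using assms by (simp add: law_sym)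
  have le: "le S (geval S \<sigma> s) (geval S \<sigma> t)" if law: "law Sc_ab s t" for s t :: "'v gterm"
  proof (cases "\<exists>\<tau>. geval Sc_ab \<tau> t \<noteq> El_inf")
    case True
    then obtain \<tau> where "geval Sc_ab \<tau> t \<noteq> El_inf" ..
    then have "le S (mval S \<sigma> w) (geval S \<sigma> t)" if "w \<in> mons s" for w
      using that
      by (rule le_geval_if_Sc_finite[where \<sigma> = \<sigma>, OF comm_ai_semiring_axioms path \<sigma> law])
    then show ?thesis
      by (rule geval_le[where \<sigma> = \<sigma>, OF \<sigma> in_S])
  next
    case False
    then have "\<exists>m\<in>cubes S. le S m (geval S \<sigma> t)"
      by (intro cube_below_if_Sc_infinite[where \<sigma> = \<sigma>, OF \<sigma>]) blast
    then obtain m where m: "m \<in> cubes S" "le S m (geval S \<sigma> t)"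
      by blast
    show ?thesis
      using le_trans[OF cube_top[OF m(1) in_S] m(2) in_S cubes_closed[OF m(1)] in_S] .
  qed
  show "geval S \<sigma> s = geval S \<sigma> t"
    using le[OF assms] le[OF st] by (rule le_antisym) (rule in_S)+
qed

text \<open>
  An identity of \<open>M\<^sub>2\<close> has the same variables on both sides: the value of a term tells whether the
  only variable with value 1 occurs in it.
\<close>

lemma geval_M2: "geval M2 (\<lambda>x. if x = z then 1 else 0) t = (if z \<in> set_gterm t then 1 else 0)"
  by (induction t) (auto simp: M2_def)

lemma set_gterm_eq_if_M2_law:
  assumes "law M2 s t"
  shows "set_gterm s = set_gterm t"
proof -
  have "geval M2 (\<lambda>x. if x = z then 1 else 0) s = geval M2 (\<lambda>x. if x = z then 1 else 0) t" for z
  proof -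
    have "range (\<lambda>x. if x = z then 1 else 0) \<subseteq> carrier M2"
      by (auto simp: M2_def)
    then show ?thesis
      using assms unfolding law_def by blast
  qed
  then have "z \<in> set_gterm s \<longleftrightarrow> z \<in> set_gterm t" for z
    unfolding geval_M2 by (metis zero_neq_one)
  then show ?thesis by blast
qed

lemma Sc_model_Sc: "Sc_model Sc_ab"
  by unfold_locales (auto simp: path_law_def le_def doubleton_eq_iff)

lemma M2_Sc_model_M2: "M2_Sc_model M2"
proof -
  interpret ai_semiring M2
    by (rule ai_semiring_M2)
  show ?thesis
    by unfold_locales (auto simp: path_law_def le_def M2_def)
qed

lemma finite_Sc: "finite (carrier Sc_ab)"
proof -
  have "carrier Sc_ab = {El_a, El_b, El_ab, El_inf}"
    using ab_elem.exhaust by auto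
  then show ?thesis by (metis finite.intros)
qed

lemma Sc_models_subset:
  fixes K :: "'u::infinite alg set"
  assumes "variety K" "copies Sc_ab \<subseteq> K" "Sc_model T"
  shows "T \<in> K"
proof (rule Birkhoff[OF assms(1)])
  interpret Sc_model T by fact
  show "ai_semiring T" by (rule ai_semiring_axioms)
  obtain C :: "'u alg" where C: "C \<in> copies Sc_ab"
    using ex_copy[OF finite_Sc] by blast
  fix s t :: "'u gterm" assume "\<And>S. S \<in> K \<Longrightarrow> law S s t"
  then have "law Sc_ab s t"
    using C assms(2) law_copies[OF ai_semiring_Sc_ab C] by blast
  then show "law T s t"
    by (rule law_if_Sc_law)
qed

lemma M2_Sc_models_subset:
  fixes K :: "'u::infinite alg set"
  assumes "variety K" "copies M2 \<union> copies Sc_ab \<subseteq> K" "M2_Sc_model T"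
  shows "T \<in> K"
proof (rule Birkhoff[OF assms(1)])
  interpret M2_Sc_model T by fact
  show "ai_semiring T" by (rule ai_semiring_axioms)
  obtain C :: "'u alg" where C: "C \<in> copies Sc_ab"
    using ex_copy[OF finite_Sc] by blast
  obtain D :: "'u alg" where D: "D \<in> copies M2"
    using ex_copy[of M2] by (auto simp: M2_def)
  fix s t :: "'u gterm" assume "\<And>S. S \<in> K \<Longrightarrow> law S s t"
  then have "law Sc_ab s t" "law M2 s t"
    using C D assms(2) law_copies[OF ai_semiring_Sc_ab C] law_copies[OF ai_semiring_M2 D] by blast+
  then show "law T s t"
    using law_if_Sc_law_same_vars set_gterm_eq_if_M2_law by blast
qed

section \<open>Identities of the greatest members\<close>

text \<open>
  Apart from commutativity, these identities compare terms with the same variables and without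
  finite value in \<open>S\<^sub>c(ab)\<close>. They survive the adjunction of a zero, because as soon as a variable
  becomes zero, the two sides turn into the same sum or both vanish.
\<close>

locale zero_model = comm_ai_semiring +
  assumes square: "x \<in> carrier S \<Longrightarrow> mul S x x = mul S (mul S x x) x"
    and square_first: "x \<in> carrier S \<Longrightarrow> y \<in> carrier S \<Longrightarrow> z \<in> carrier S \<Longrightarrow>
      mul S (mul S x y) z = mul S (mul S (mul S x x) y) z"
    and le_square: "x \<in> carrier S \<Longrightarrow> add S x (mul S x x) = mul S x x"
    and zero_mixed: "x \<in> carrier S \<Longrightarrow> y \<in> carrier S \<Longrightarrow>
      add S (mul S (mul S x x) y) (add S x (mul S x y)) = add S x (mul S x y)"
    and zero_cube_add: "x \<in> carrier S \<Longrightarrow> y \<in> carrier S \<Longrightarrow> z \<in> carrier S \<Longrightarrow> w \<in> carrier S \<Longrightarrow>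
      add S (mul S (mul S (mul S x y) z) w) (add S (mul S (mul S x y) z) w)
        = add S (mul S (mul S x y) z) w"

definition law_square_first :: "trm \<times> trm" where
  "law_square_first = (Mul (Mul (Var 0) (Var 1)) (Var 2),
     Mul (Mul (Mul (Var 0) (Var 0)) (Var 1)) (Var 2))"

definition law_le_square :: "trm \<times> trm" where
  "law_le_square = (Add (Var 0) (Mul (Var 0) (Var 0)), Mul (Var 0) (Var 0))"

definition law_zero_mixed :: "trm \<times> trm" where
  "law_zero_mixed = (let t = Add (Var 0) (Mul (Var 0) (Var 1))
     in (Add (Mul (Mul (Var 0) (Var 0)) (Var 1)) t, t))"

definition law_zero_cube_add :: "trm \<times> trm" where
  "law_zero_cube_add = (let m = Mul (Mul (Var 0) (Var 1)) (Var 2); t = Add m (Var 3)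
     in (Add (Mul m (Var 3)) t, t))"

definition law_square_top :: "trm \<times> trm" where
  "law_square_top = (Add (Mul (Mul (Var 0) (Var 0)) (Var 1)) (Mul (Var 0) (Var 0)),
     Mul (Var 0) (Var 0))"

definition zero_laws :: "(trm \<times> trm) set" where
  "zero_laws = {law_comm, law_square, law_square_first, law_le_square, law_zero_mixed,
     law_zero_cube_add}"

lemma zero_model_if_satisfies:
  assumes ai: "ai_semiring S" and S: "\<And>e. e \<in> zero_laws \<Longrightarrow> satisfies S e"
  shows "zero_model S"
proof (intro zero_model.intro zero_model_axioms.intro)
  show "comm_ai_semiring S"
    using ai S by (simp add: zero_laws_def comm_ai_semiring_iff)
  fix x y z w assume x: "x \<in> carrier S"
  show "mul S x x = mul S (mul S x x) x"
    using satisfies_assign4[of S law_square x x x x] S x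
    by (simp add: zero_laws_def law_square_def)
  show "add S x (mul S x x) = mul S x x"
    using satisfies_assign4[of S law_le_square x x x x] S x
    by (simp add: zero_laws_def law_le_square_def)
  assume y: "y \<in> carrier S"
  show "add S (mul S (mul S x x) y) (add S x (mul S x y)) = add S x (mul S x y)"
    using satisfies_assign4[of S law_zero_mixed x y x x] S x y
    by (simp add: zero_laws_def law_zero_mixed_def Let_def)
  assume z: "z \<in> carrier S"
  show "mul S (mul S x y) z = mul S (mul S (mul S x x) y) z"
    using satisfies_assign4[of S law_square_first x y z x] S x y z
    by (simp add: zero_laws_def law_square_first_def)
  assume "w \<in> carrier S"
  then show "add S (mul S (mul S (mul S x y) z) w) (add S (mul S (mul S x y) z) w)
      = add S (mul S (mul S x y) z) w"
    using satisfies_assign4[of S law_zero_cube_add x y z w] S x y z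
    by (simp add: zero_laws_def law_zero_cube_add_def Let_def)
qed

text \<open>
  Closing the walk \<open>y, x, x, y\<close> by the path law and multiplying by \<open>y\<close> gives \<open>yy \<le> xxy\<close>, which
  fails for \<open>x = 0\<close> and \<open>y = \<infinity>\<close>. Hence a product \<open>xxy\<close> lies above its factors, which turns the
  inequalities above into the equations of the basis.
\<close>

lemma (in zero_model) M2_Sc_model_if_path_law:
  assumes path: "path_law S"
  shows "M2_Sc_model S"
proof -
  have sq2: "mul S x (mul S x y) = mul S x (mul S x (mul S y y))"
    if "x \<in> carrier S" "y \<in> carrier S" for x y
    using square_first[of y x x] that by (simp add: mul_ac mul_closed)
  have sym: "mul S x (mul S x y) = mul S y (mul S y x)" if "x \<in> carrier S" "y \<in> carrier S" for x y
  proof -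
    have "mul S x (mul S x (mul S y y)) = mul S y (mul S y (mul S x x))"
      using that by (simp add: mul_ac mul_closed)
    then show ?thesis
      using sq2[OF that] sq2[OF that(2,1)] by simp
  qed
  have sq_le: "le S (mul S y y) (mul S x (mul S x y))"
    if xy: "x \<in> carrier S" "y \<in> carrier S" for x y
  proof -
    let ?P = "add S (add S (mul S y x) (mul S x x)) (mul S x y)"
    have "le S (mul S y y) ?P"
      using path xy unfolding path_law_def by blast
    then have "le S (mul S y (mul S y y)) (mul S y ?P)"
      by (rule mul_mono_left) (simp_all add: xy mul_closed add_closed)
    moreover have "mul S y ?P = mul S x (mul S x y)"
      using sym[OF xy] xy
      by (simp add: distrib_left mul_closed add_closed mul_ac add_idem)
    moreover have "mul S y (mul S y y) = mul S y y"
      using square[OF xy(2)] xy by (simp add: mul_assoc)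
    ultimately show ?thesis by simp
  qed
  have le_right: "le S y (mul S x (mul S x y))" if "x \<in> carrier S" "y \<in> carrier S" for x y
  proof -
    have "le S y (mul S y y)"
      using le_square that by (simp add: le_def)
    then show ?thesis
      using sq_le[OF that] by (rule le_trans) (simp_all add: that mul_closed)
  qed
  have le_left: "le S x (mul S x (mul S x y))" if "x \<in> carrier S" "y \<in> carrier S" for x y
    using le_right[OF that(2,1)] sym[OF that] by simp
  show ?thesis
  proof (intro M2_Sc_model.intro M2_Sc_model_axioms.intro)
    fix x y z w assume x: "x \<in> carrier S" and y: "y \<in> carrier S"
    have xy: "mul S x y \<in> carrier S" "mul S x (mul S x y) \<in> carrier S"
      using x y by (simp_all add: mul_closed)
    have "le S (mul S x y) (mul S (mul S x y) (mul S x y))"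
      using le_square[OF xy(1)] by (simp add: le_def)
    moreover have "mul S (mul S x y) (mul S x y) = mul S x (mul S x y)"
      using sq2[OF x y] x y by (simp add: mul_ac mul_closed)
    ultimately have "le S (add S x (mul S x y)) (mul S x (mul S x y))"
      using le_left[OF x y] x xy by (intro add_le) simp_all
    moreover have "le S (mul S x (mul S x y)) (add S x (mul S x y))"
      using zero_mixed[OF x y] x y by (simp add: le_def mul_assoc)
    ultimately have "add S x (mul S x y) = mul S x (mul S x y)"
      by (rule le_antisym) (simp_all add: x xy add_closed)
    then show "add S x (mul S x y) = mul S (mul S x x) y"
      using x y by (simp add: mul_assoc)
    assume z: "z \<in> carrier S" and w: "w \<in> carrier S"
    define m where "m = mul S (mul S x y) z"
    have m: "m \<in> carrier S"
      using x y z by (simp add: m_def mul_closed)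
    have "mul S m w = mul S (mul S x (mul S y z)) w"
      using x y z w by (simp add: m_def mul_assoc mul_closed)
    also have "\<dots> = mul S (mul S (mul S y z) (mul S x x)) w"
      using square_first[of x "mul S y z" w] x y z w by (simp add: mul_ac mul_closed)
    also have "\<dots> = mul S (mul S (mul S (mul S y z) (mul S y z)) (mul S x x)) w"
      using x y z w by (intro square_first) (simp_all add: mul_closed)
    also have "\<dots> = mul S m (mul S m w)"
      using x y z w by (simp add: m_def mul_ac mul_closed)
    finally have mm: "mul S m w = mul S m (mul S m w)" .
    have "le S (add S m w) (mul S m w)"
      using le_left[OF m w] le_right[OF m w] mm m w by (intro add_le) (simp_all add: mul_closed)
    moreover have "le S (mul S m w) (add S m w)"
      using zero_cube_add[OF x y z w] by (simp add: le_def m_def)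
    ultimately have "add S m w = mul S m w"
      by (rule le_antisym) (simp_all add: m w mul_closed add_closed)
    then show "add S (mul S (mul S x y) z) w = mul S (mul S (mul S x y) z) w"
      by (simp add: m_def)
  qed (use path square comm_ai_semiring_axioms in simp_all)
qed

text \<open>
  The identity \<open>xx \<ge> xxy\<close> fails in \<open>M\<^sub>2\<close>. Since \<open>xx + y = xxy\<close>, it lets a square absorb every
  factor, so that \<open>xx = xxy = yyx = yy\<close>.
\<close>

lemma (in zero_model) Sc_model_if_path_law:
  assumes path: "path_law S" and top: "satisfies S law_square_top"
  shows "Sc_model S"
proof -
  interpret M2_Sc_model S
    using path by (rule M2_Sc_model_if_path_law)
  have absorb: "mul S (mul S x x) y = mul S x x" if xy: "x \<in> carrier S" "y \<in> carrier S" for x y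
  proof (rule le_antisym)
    show "le S (mul S (mul S x x) y) (mul S x x)"
      using satisfies_assign4[OF top, of x y x x] xy by (simp add: law_square_top_def le_def)
    have "mul S x x \<in> cubes S"
      using square[OF xy(1)] cubesI[OF xy(1) xy(1) xy(1)] by simp
    then show "le S (mul S x x) (mul S (mul S x x) y)"
      using cubes_add[of "mul S x x" y] le_add1[of "mul S x x" y] xy by (simp add: mul_closed)
  qed (simp_all add: xy mul_closed)
  have "mul S x x = mul S y y" if xy: "x \<in> carrier S" "y \<in> carrier S" for x y
  proof -
    have "mul S x x = mul S (mul S y x) x"
      using absorb[OF xy] xy by (simp add: mul_ac mul_closed)
    also have "\<dots> = mul S (mul S (mul S y y) x) x"
      by (rule square_first) (rule xy)+
    also have "\<dots> = mul S y y"
      using absorb[OF xy(2,1)] by simp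
    finally show ?thesis .
  qed
  then show ?thesis
    by unfold_locales
qed

section \<open>Adjoining a zero\<close>

lemma adjoin_zero_simps[simp]:
  "carrier (adjoin_zero S) = insert None (Some ` carrier S)"
  "add (adjoin_zero S) = zero_add (add S)"
  "mul (adjoin_zero S) = zero_mul (mul S)"
  by (simp_all add: adjoin_zero_def)

lemma zero_add_None[simp]: "zero_add f u None = u"
  by (cases u) auto

lemma zero_mul_None[simp]: "zero_mul f u None = None"
  by (cases u) auto

lemma comm_ai_semiring_adjoin_zero:
  assumes "comm_ai_semiring S"
  shows "comm_ai_semiring (adjoin_zero S)"
proof -
  interpret comm_ai_semiring S by fact
  show ?thesis
    by (intro comm_ai_semiring.intro comm_ai_semiring_axioms.intro ai_semiring_adjoin_zero)
      (auto simp: ai_semiring_axioms mul_comm)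
qed

lemma satisfies_zero_laws:
  assumes "zero_model S" "e \<in> zero_laws"
  shows "satisfies S e"
proof -
  interpret zero_model S by fact
  have "eval S \<sigma> (fst e) = eval S \<sigma> (snd e)" if "range \<sigma> \<subseteq> carrier S" for \<sigma>
  proof -
    have \<sigma>: "\<sigma> n \<in> carrier S" for n
      using that by blast
    from assms(2) show ?thesis
      unfolding zero_laws_def
    proof (elim insertE emptyE)
      assume "e = law_comm"
      then show ?thesis by (simp add: law_comm_def mul_comm \<sigma>)
    next
      assume "e = law_square"
      then show ?thesis using square[OF \<sigma>, of 0] by (simp add: law_square_def)
    next
      assume "e = law_square_first"
      then show ?thesis using square_first[OF \<sigma> \<sigma> \<sigma>, of 0 1 2] by (simp add: law_square_first_def)
    next
      assume "e = law_le_square"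
      then show ?thesis by (simp add: law_le_square_def le_square \<sigma>)
    next
      assume "e = law_zero_mixed"
      then show ?thesis by (simp add: law_zero_mixed_def Let_def zero_mixed \<sigma>)
    next
      assume "e = law_zero_cube_add"
      then show ?thesis by (simp add: law_zero_cube_add_def Let_def zero_cube_add \<sigma>)
    qed
  qed
  then show ?thesis
    by (simp add: satisfies_def)
qed

lemma mul_Sc_cube: "mul Sc_ab (mul Sc_ab x y) z = El_inf"
  by (auto simp: doubleton_eq_iff)

lemma mul_Sc_inf: "mul Sc_ab El_inf x = El_inf"
  by (auto simp: doubleton_eq_iff)

lemma mul_Sc_square: "mul Sc_ab x x = El_inf"
  by (auto simp: doubleton_eq_iff)

lemma zero_model_Sc: "zero_model (adjoin_zero Sc_ab)"
proof (intro zero_model.intro zero_model_axioms.intro comm_ai_semiring_adjoin_zero)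
  show "comm_ai_semiring Sc_ab"
    by (rule Sc.comm_ai_semiring_axioms)
  fix x y z w :: "ab_elem option"
  show "mul (adjoin_zero Sc_ab) x x = mul (adjoin_zero Sc_ab) (mul (adjoin_zero Sc_ab) x x) x"
    by (cases x) (simp_all add: mul_Sc_square mul_Sc_inf del: mul_Sc)
  show "add (adjoin_zero Sc_ab) x (mul (adjoin_zero Sc_ab) x x) = mul (adjoin_zero Sc_ab) x x"
    by (cases x) (simp_all add: mul_Sc_square mul_Sc_inf del: mul_Sc)
  show "mul (adjoin_zero Sc_ab) (mul (adjoin_zero Sc_ab) x y) z
      = mul (adjoin_zero Sc_ab) (mul (adjoin_zero Sc_ab) (mul (adjoin_zero Sc_ab) x x) y) z"
    by (cases x; cases y; cases z) (simp_all add: mul_Sc_cube mul_Sc_inf del: mul_Sc)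
  show "add (adjoin_zero Sc_ab) (mul (adjoin_zero Sc_ab) (mul (adjoin_zero Sc_ab) x x) y)
        (add (adjoin_zero Sc_ab) x (mul (adjoin_zero Sc_ab) x y))
      = add (adjoin_zero Sc_ab) x (mul (adjoin_zero Sc_ab) x y)"
    by (cases x; cases y) (auto simp: doubleton_eq_iff)
  show "add (adjoin_zero Sc_ab)
        (mul (adjoin_zero Sc_ab) (mul (adjoin_zero Sc_ab) (mul (adjoin_zero Sc_ab) x y) z) w)
        (add (adjoin_zero Sc_ab) (mul (adjoin_zero Sc_ab) (mul (adjoin_zero Sc_ab) x y) z) w)
      = add (adjoin_zero Sc_ab) (mul (adjoin_zero Sc_ab) (mul (adjoin_zero Sc_ab) x y) z) w"
    by (cases x; cases y; cases z; cases w) (simp_all add: mul_Sc_cube mul_Sc_inf del: mul_Sc)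
qed

lemma zero_model_M2: "zero_model (adjoin_zero M2)"
proof (intro zero_model.intro zero_model_axioms.intro comm_ai_semiring_adjoin_zero)
  interpret M2_Sc_model M2 by (rule M2_Sc_model_M2)
  show "comm_ai_semiring M2"
    by (rule comm_ai_semiring_axioms)
qed (auto simp: M2_def)

lemma satisfies_square_top: "satisfies (adjoin_zero Sc_ab) law_square_top"
proof -
  have "add (adjoin_zero Sc_ab) (mul (adjoin_zero Sc_ab) (mul (adjoin_zero Sc_ab) x x) y)
      (mul (adjoin_zero Sc_ab) x x) = mul (adjoin_zero Sc_ab) x x" for x y
    by (cases x; cases y) (simp_all add: mul_Sc_square mul_Sc_inf del: mul_Sc)
  then show ?thesis
    by (simp add: satisfies_def law_square_top_def del: adjoin_zero_simps)
qed

lemma geval_adjoin_zero: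
  "(\<And>x. x \<in> set_gterm t \<Longrightarrow> \<sigma> x = Some (\<tau> x)) \<Longrightarrow> geval (adjoin_zero S) \<sigma> t = Some (geval S \<tau> t)"
  by (induction t) auto

text \<open>
  Assignments without the value zero do not leave \<open>S\<close>.
\<close>

lemma law_if_adjoin_zero_law:
  assumes "law (adjoin_zero S) s t"
  shows "law S s t"
  unfolding law_def
proof (intro allI impI)
  fix \<tau> :: "'b \<Rightarrow> 'a" assume "range \<tau> \<subseteq> carrier S"
  then have "range (\<lambda>x. Some (\<tau> x)) \<subseteq> carrier (adjoin_zero S)"
    by auto
  then have "geval (adjoin_zero S) (\<lambda>x. Some (\<tau> x)) s = geval (adjoin_zero S) (\<lambda>x. Some (\<tau> x)) t"
    using assms unfolding law_def by blast
  then show "geval S \<tau> s = geval S \<tau> t"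
    by (simp add: geval_adjoin_zero[of _ _ \<tau>])
qed

section \<open>The identities of odd cycles\<close>

primrec path_trm :: "nat \<Rightarrow> trm" where
  "path_trm 0 = Mul (Var 0) (Var 1)"
| "path_trm (Suc n) = Add (path_trm n) (Mul (Var (Suc n)) (Var (Suc (Suc n))))"

primrec prod_trm :: "nat \<Rightarrow> trm" where
  "prod_trm 0 = Var 0"
| "prod_trm (Suc n) = Mul (prod_trm n) (Var (Suc n))"

definition cycle_trm :: "nat \<Rightarrow> trm" where
  "cycle_trm n = Add (path_trm n) (Mul (Var (Suc n)) (Var 0))"

definition law_cycle :: "nat \<Rightarrow> trm \<times> trm" where
  "law_cycle n = (Add (prod_trm (Suc n)) (cycle_trm n), cycle_trm n)"

lemma set_path_trm: "set_gterm (gterm_of (path_trm n)) = {..Suc n}"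
  by (induction n) (auto simp: atMost_Suc)

lemma set_prod_trm: "set_gterm (gterm_of (prod_trm n)) = {..n}"
  by (induction n) (auto simp: atMost_Suc)

lemma set_cycle_trm: "set_gterm (gterm_of (cycle_trm n)) = {..Suc n}"
  by (auto simp: cycle_trm_def set_path_trm)

lemma eval_prod_None: "i \<le> n \<Longrightarrow> \<sigma> i = None \<Longrightarrow> eval (adjoin_zero S) \<sigma> (prod_trm n) = None"
  by (induction n) (auto simp: le_Suc_eq)

lemma path_alternates:
  "eval Sc_ab \<tau> (path_trm n) = c \<Longrightarrow> c \<noteq> El_inf \<Longrightarrow> i \<le> Suc n \<Longrightarrow>
    {\<tau> 0, \<tau> 1} = {El_a, El_b} \<and> c = El_ab \<and> (\<tau> i = \<tau> 0 \<longleftrightarrow> even i) \<and> \<tau> i \<in> {El_a, El_b}"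
proof (induction n arbitrary: i c)
  case 0
  then have "i = 0 \<or> i = 1" by linarith
  then show ?case using 0 by (auto split: if_splits simp: doubleton_eq_iff)
next
  case (Suc n)
  have c: "eval Sc_ab \<tau> (path_trm n) = c" and e: "mul Sc_ab (\<tau> (Suc n)) (\<tau> (Suc (Suc n))) = c"
    using Suc.prems(1,2) by (auto split: if_splits)
  show ?case
  proof (cases "i \<le> Suc n")
    case True
    then show ?thesis by (rule Suc.IH[OF c Suc.prems(2)])
  next
    case False
    then have i: "i = Suc (Suc n)"
      using Suc.prems(3) by simp
    show ?thesis
      using Suc.IH[OF c Suc.prems(2), of "Suc n"] e Suc.prems(2)
      by (auto simp: i doubleton_eq_iff split: if_splits)
  qed
qed

lemma eval_odd_cycle_Sc:
  assumes "odd n"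
  shows "eval Sc_ab \<tau> (cycle_trm n) = El_inf"
proof (rule ccontr)
  assume "eval Sc_ab \<tau> (cycle_trm n) \<noteq> El_inf"
  then have "eval Sc_ab \<tau> (path_trm n) \<noteq> El_inf" and e: "mul Sc_ab (\<tau> (Suc n)) (\<tau> 0) \<noteq> El_inf"
    by (auto simp: cycle_trm_def split: if_splits)
  then have "\<tau> (Suc n) = \<tau> 0"
    using path_alternates[OF refl, of \<tau> n "Suc n"] assms by simp
  then show False
    using e by (auto simp: doubleton_eq_iff split: if_splits)
qed

text \<open>
  A cycle of odd length is not 2-colourable, but becomes a union of paths when a vertex is
  deleted. The product of all vertices, which vanishes as soon as a vertex becomes zero, can
  therefore be added to the sum of the edges.
\<close>

lemma satisfies_cycle_adjoin_zero:
  assumes "\<And>\<tau>. range \<tau> \<subseteq> carrier S \<Longrightarrow> add S (eval S \<tau> (prod_trm (Suc n))) (eval S \<tau> (cycle_trm n))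
    = eval S \<tau> (cycle_trm n)"
    and "carrier S \<noteq> {}"
  shows "satisfies (adjoin_zero S) (law_cycle n)"
  unfolding satisfies_def
proof (intro allI impI)
  fix \<sigma> :: "nat \<Rightarrow> 'a option" assume \<sigma>: "range \<sigma> \<subseteq> carrier (adjoin_zero S)"
  show "eval (adjoin_zero S) \<sigma> (fst (law_cycle n)) = eval (adjoin_zero S) \<sigma> (snd (law_cycle n))"
  proof (cases "\<exists>i\<le>Suc n. \<sigma> i = None")
    case True
    then have "eval (adjoin_zero S) \<sigma> (prod_trm (Suc n)) = None"
      using eval_prod_None by blast
    then show ?thesis
      by (simp add: law_cycle_def del: prod_trm.simps)
  next
    case False
    obtain z where z: "z \<in> carrier S"
      using assms(2) by blast
    define \<tau> where "\<tau> i = (case \<sigma> i of None \<Rightarrow> z | Some x \<Rightarrow> x)" for i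
    have "\<tau> i \<in> carrier S" for i
    proof -
      have "\<sigma> i \<in> carrier (adjoin_zero S)"
        using \<sigma> by blast
      then show ?thesis
        using z by (auto simp: \<tau>_def)
    qed
    then have "add S (eval S \<tau> (prod_trm (Suc n))) (eval S \<tau> (cycle_trm n)) = eval S \<tau> (cycle_trm n)"
      by (intro assms(1)) blast
    moreover have "eval (adjoin_zero S) \<sigma> t = Some (eval S \<tau> t)"
      if "set_gterm (gterm_of t) \<subseteq> {..Suc n}" for t
      unfolding geval_gterm_of[symmetric]
      by (rule geval_adjoin_zero) (use that False in \<open>auto simp: \<tau>_def split: option.split\<close>)
    ultimately show ?thesis
      by (simp add: law_cycle_def set_prod_trm set_cycle_trm del: prod_trm.simps)
  qed
qed

lemma geval_M2_le_iff: "geval M2 \<sigma> t \<le> z \<longleftrightarrow> (\<forall>x\<in>set_gterm t. \<sigma> x \<le> z)"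
  by (induction t) (auto simp: M2_def)

lemma satisfies_odd_cycle:
  assumes "odd n"
  shows "satisfies (adjoin_zero Sc_ab) (law_cycle n)" "satisfies (adjoin_zero M2) (law_cycle n)"
proof -
  show "satisfies (adjoin_zero Sc_ab) (law_cycle n)"
    by (rule satisfies_cycle_adjoin_zero) (simp_all add: eval_odd_cycle_Sc[OF assms])
  have "eval M2 \<tau> (prod_trm (Suc n)) \<le> eval M2 \<tau> (cycle_trm n)" for \<tau>
    unfolding geval_gterm_of[symmetric] geval_M2_le_iff set_prod_trm
    using geval_M2_le_iff[of \<tau> "gterm_of (cycle_trm n)" "geval M2 \<tau> (gterm_of (cycle_trm n))"]
    by (simp add: set_cycle_trm)
  then show "satisfies (adjoin_zero M2) (law_cycle n)"
    by (intro satisfies_cycle_adjoin_zero) (simp_all add: M2_def max_def del: prod_trm.simps)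
qed

section \<open>The algebra of divisors of a polynomial\<close>

text \<open>
  A polynomial is a set of commutative monomials. It is a divisor of \<open>C\<close> if some monomial
  multiplies it into a part of \<open>C\<close>. The other polynomials form an ideal, also with respect to
  addition, of the semiring of all nonempty polynomials without constant term. The quotient
  \<open>divisor_alg C\<close> collapses this ideal to a single element, represented by the empty set.
\<close>

definition divisor :: "'b multiset set \<Rightarrow> 'b multiset set \<Rightarrow> bool" where
  "divisor C p \<longleftrightarrow> p \<noteq> {} \<and> {#} \<notin> p \<and> (\<exists>m. \<forall>w\<in>p. w + m \<in> C)"

definition clip :: "'b multiset set \<Rightarrow> 'b multiset set \<Rightarrow> 'b multiset set" where
  "clip C p = (if divisor C p then p else {})"

definition setmul :: "'b multiset set \<Rightarrow> 'b multiset set \<Rightarrow> 'b multiset set" where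
  "setmul p q = {u + v | u v. u \<in> p \<and> v \<in> q}"

definition divisor_alg :: "'b multiset set \<Rightarrow> 'b multiset set alg" where
  "divisor_alg C = \<lparr>carrier = insert {} {p. divisor C p},
     add = \<lambda>p q. if p = {} \<or> q = {} then {} else clip C (p \<union> q),
     mul = \<lambda>p q. clip C (setmul p q)\<rparr>"

lemma divisor_alg_simps[simp]:
  "carrier (divisor_alg C) = insert {} {p. divisor C p}"
  "add (divisor_alg C) p q = (if p = {} \<or> q = {} then {} else clip C (p \<union> q))"
  "mul (divisor_alg C) p q = clip C (setmul p q)"
  by (simp_all add: divisor_alg_def)

lemma setmul_empty[simp]: "setmul {} q = {}" "setmul p {} = {}"
  by (auto simp: setmul_def)

lemma setmul_eq_empty_iff: "setmul p q = {} \<longleftrightarrow> p = {} \<or> q = {}"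
  by (auto simp: setmul_def)

lemma setmul_comm: "setmul p q = setmul q p"
  unfolding setmul_def by (metis (no_types, opaque_lifting) add.commute)

lemma setmul_assoc: "setmul (setmul p q) r = setmul p (setmul q r)"
proof
  show "setmul (setmul p q) r \<subseteq> setmul p (setmul q r)"
    unfolding setmul_def by (fastforce simp: add.assoc)
  show "setmul p (setmul q r) \<subseteq> setmul (setmul p q) r"
    unfolding setmul_def by (fastforce simp: add.assoc[symmetric])
qed

lemma setmul_Un: "setmul p (q \<union> r) = setmul p q \<union> setmul p r"
  by (auto simp: setmul_def)

lemma divisor_nonempty: "divisor C p \<Longrightarrow> p \<noteq> {}"
  by (simp add: divisor_def)

lemma clip_empty[simp]: "clip C {} = {}"
  by (simp add: clip_def)

lemma clip_eq: "clip C p \<noteq> {} \<Longrightarrow> clip C p = p \<and> divisor C p"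
  by (simp add: clip_def split: if_splits)

lemma divisor_subset: "divisor C q \<Longrightarrow> p \<subseteq> q \<Longrightarrow> p \<noteq> {} \<Longrightarrow> divisor C p"
  unfolding divisor_def by (meson subsetD)

text \<open>
  This is the ideal property: a product with a polynomial outside the divisors is no divisor.
\<close>

lemma divisor_factor:
  assumes "divisor C (setmul p q)" "{#} \<notin> p"
  shows "divisor C p"
proof -
  obtain m where m: "\<forall>w\<in>setmul p q. w + m \<in> C"
    using assms(1) by (auto simp: divisor_def)
  have ne: "p \<noteq> {}" "q \<noteq> {}"
    using divisor_nonempty[OF assms(1)] by (auto simp: setmul_eq_empty_iff)
  then obtain v where v: "v \<in> q"
    by blast
  have "u + (v + m) \<in> C" if "u \<in> p" for u
  proof -
    have "u + v \<in> setmul p q"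
      using that v by (auto simp: setmul_def)
    then have "u + v + m \<in> C"
      using m by blast
    then show ?thesis
      by (simp add: add.assoc)
  qed
  then show ?thesis
    using ne(1) assms(2) by (auto simp: divisor_def)
qed

lemma clip_Un_empty: "p \<noteq> {} \<Longrightarrow> clip C p = {} \<Longrightarrow> clip C (p \<union> r) = {}"
  unfolding clip_def using divisor_subset[of C "p \<union> r" p] by (auto dest: divisor_nonempty)

lemma clip_setmul_clip:
  assumes "{#} \<notin> p"
  shows "clip C (setmul (clip C p) q) = clip C (setmul p q)"
proof (cases "divisor C p")
  case False
  then have "\<not> divisor C (setmul p q)"
    using divisor_factor assms by blast
  then show ?thesis using False by (simp add: clip_def)
qed (simp add: clip_def)

lemma no_Nil: "p \<in> carrier (divisor_alg C) \<Longrightarrow> {#} \<notin> p"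
  by (auto simp: divisor_def)

lemma clip_in: "clip C p \<in> carrier (divisor_alg C)"
  by (simp add: clip_def)

lemma comm_ai_semiring_divisor_alg: "comm_ai_semiring (divisor_alg C)"
proof (intro comm_ai_semiring.intro comm_ai_semiring_axioms.intro ai_semiring.intro)
  let ?A = "divisor_alg C"
  show "carrier ?A \<noteq> {}"
    by simp
  fix p q r assume p: "p \<in> carrier ?A" and q: "q \<in> carrier ?A"
  show "add ?A p q \<in> carrier ?A" "mul ?A p q \<in> carrier ?A"
    using clip_in[of C] by auto
  show "add ?A p q = add ?A q p"
    by (auto simp: Un_commute)
  show comm: "mul ?A p q = mul ?A q p" for p q
    by (simp add: setmul_comm)
  show "add ?A p p = p"
    using p by (auto simp: clip_def)
  assume r: "r \<in> carrier ?A"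
  show "add ?A (add ?A p q) r = add ?A p (add ?A q r)"
  proof (cases "p = {} \<or> q = {} \<or> r = {}")
    case False
    have "add ?A (add ?A p q) r = clip C (p \<union> q \<union> r)"
      using False clip_Un_empty[of "p \<union> q" C r] clip_eq[of C "p \<union> q"]
      by (cases "clip C (p \<union> q) = {}") simp_all
    moreover have "add ?A p (add ?A q r) = clip C (p \<union> (q \<union> r))"
      using False clip_Un_empty[of "q \<union> r" C p] clip_eq[of C "q \<union> r"]
      by (cases "clip C (q \<union> r) = {}") (simp_all add: Un_commute[of p])
    ultimately show ?thesis
      by (simp add: Un_assoc)
  qed auto
  have Nil: "{#} \<notin> setmul p q" if "{#} \<notin> p" for p q :: "'a multiset set"
    using that by (auto simp: setmul_def)
  have "mul ?A (mul ?A p q) r = clip C (setmul (setmul p q) r)"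
    using clip_setmul_clip[OF Nil] no_Nil[OF p] by simp
  moreover have "mul ?A p (mul ?A q r) = clip C (setmul (setmul q r) p)"
    unfolding comm[of p] using clip_setmul_clip[OF Nil] no_Nil[OF q] by simp
  ultimately show "mul ?A (mul ?A p q) r = mul ?A p (mul ?A q r)"
    using setmul_comm[of p "setmul q r"] by (simp add: setmul_assoc)
  have distrib: "mul ?A p (add ?A q r) = add ?A (mul ?A p q) (mul ?A p r)"
    if q: "q \<in> carrier ?A" and r: "r \<in> carrier ?A" for p q r
  proof (cases "p = {} \<or> q = {} \<or> r = {}")
    case False
    have "{#} \<notin> q \<union> r"
      using no_Nil[OF q] no_Nil[OF r] by simp
    then have "mul ?A p (add ?A q r) = clip C (setmul p q \<union> setmul p r)"
      using False clip_setmul_clip[of "q \<union> r" C p]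
      by (simp add: setmul_comm[of p "clip C (q \<union> r)"] setmul_comm[of "q \<union> r" p] setmul_Un)
    moreover have "add ?A (mul ?A p q) (mul ?A p r) = clip C (setmul p q \<union> setmul p r)"
    proof -
      have "setmul p q \<noteq> {}" "setmul p r \<noteq> {}"
        using False by (simp_all add: setmul_eq_empty_iff)
      then show ?thesis
        using clip_Un_empty[of "setmul p q" C "setmul p r"] clip_Un_empty[of "setmul p r" C "setmul p q"]
          clip_eq[of C "setmul p q"] clip_eq[of C "setmul p r"]
        by (cases "clip C (setmul p q) = {}"; cases "clip C (setmul p r) = {}")
          (simp_all add: Un_commute[of "setmul p r"])
    qed
    ultimately show ?thesis by simp
  qed auto
  show "mul ?A p (add ?A q r) = add ?A (mul ?A p q) (mul ?A p r)"
    by (rule distrib[OF q r])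
  show "mul ?A (add ?A p q) r = add ?A (mul ?A p r) (mul ?A q r)"
    using distrib[OF p q, of r] unfolding comm[of r] .
qed

lemma le_divisor_alg: "le (divisor_alg C) p q \<Longrightarrow> q \<noteq> {} \<Longrightarrow> p \<noteq> {} \<and> p \<subseteq> q"
  using clip_eq[of C "p \<union> q"] by (auto simp: le_def split: if_splits)

section \<open>Divisors of a long odd cycle\<close>

text \<open>
  The vertices are \<open>0, ..., n + 1\<close>, so the cycle has odd length if \<open>n\<close> is odd. The divisors of
  the sum of its edges are the nonempty sets of edges and the nonempty sets of vertices with a
  common neighbour.
\<close>

definition cycle :: "nat \<Rightarrow> nat multiset set" where
  "cycle n = insert {#Suc n, 0#} {{#i, Suc i#} | i. i \<le> n}"

lemma size_cycle: "w \<in> cycle n \<Longrightarrow> size w = 2"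
  by (auto simp: cycle_def)

lemma edge_in_cycle_iff:
  "{#i, j#} \<in> cycle n \<longleftrightarrow> (j = Suc i \<and> i \<le> n) \<or> (i = Suc j \<and> j \<le> n)
    \<or> (i = Suc n \<and> j = 0) \<or> (i = 0 \<and> j = Suc n)"
  by (auto simp: cycle_def add_eq_conv_ex add_mset_eq_single)

lemma divisor_size:
  assumes "divisor (cycle n) p"
  obtains "\<And>w. w \<in> p \<Longrightarrow> size w = 1" | "p \<subseteq> cycle n"
proof -
  obtain m where m: "\<And>w. w \<in> p \<Longrightarrow> w + m \<in> cycle n" and p: "{#} \<notin> p" "p \<noteq> {}"
    using assms by (auto simp: divisor_def)
  have size: "size w + size m = 2" "size w \<noteq> 0" if "w \<in> p" for w
    using size_cycle[OF m[OF that]] that p(1) by auto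
  show thesis
  proof (cases "m = {#}")
    case True
    then show thesis using m by (intro that(2)) auto
  next
    case False
    then have m: "size m \<noteq> 0" by simp
    show thesis
    proof (rule that(1))
      show "size w = 1" if "w \<in> p" for w
        using size[OF that] m by linarith
    qed
  qed
qed

lemma finite_divisor_alg_cycle: "finite (carrier (divisor_alg (cycle n)))"
proof -
  let ?D = "\<Union>k\<le>2. multisets_of_size {..Suc n} k"
  have C: "set_mset c \<subseteq> {..Suc n}" if "c \<in> cycle n" for c
    using that by (auto simp: cycle_def)
  have "w \<in> ?D" if "w + m \<in> cycle n" for w m
    using C[OF that] size_cycle[OF that] by (auto simp: multisets_of_size_def)
  then have "carrier (divisor_alg (cycle n)) \<subseteq> Pow ?D"
    by (auto simp: divisor_def)
  moreover have "finite (Pow ?D)"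
    by auto
  ultimately show ?thesis
    by (rule finite_subset)
qed

text \<open>
  The monomials of the sum of the edges have degree two.
\<close>

lemma cube_divisor_alg_cycle:
  assumes "p \<in> carrier (divisor_alg (cycle n))" "q \<in> carrier (divisor_alg (cycle n))"
    "r \<in> carrier (divisor_alg (cycle n))"
  shows "mul (divisor_alg (cycle n)) (mul (divisor_alg (cycle n)) p q) r = {}"
proof (rule ccontr)
  assume ne: "\<not> ?thesis"
  then have "clip (cycle n) (setmul p q) \<noteq> {}"
    by auto
  then have "clip (cycle n) (setmul p q) = setmul p q"
    using clip_eq by blast
  then have d: "divisor (cycle n) (setmul (setmul p q) r)"
    using ne clip_eq[of "cycle n" "setmul (setmul p q) r"] by simp
  have "p \<noteq> {}" "q \<noteq> {}" "r \<noteq> {}"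
    using divisor_nonempty[OF d] by (auto simp: setmul_eq_empty_iff)
  then obtain u v w where uvw: "u \<in> p" "v \<in> q" "w \<in> r"
    by blast
  then have "u + v + w \<in> setmul (setmul p q) r"
    unfolding setmul_def by blast
  then obtain m where "u + v + w + m \<in> cycle n"
    using d by (auto simp: divisor_def)
  then have "size u + size v + size w \<le> 2"
    using size_cycle by fastforce
  moreover have "u \<noteq> {#}" "v \<noteq> {#}" "w \<noteq> {#}"
    using uvw assms no_Nil by blast+
  then have "size u \<ge> 1" "size v \<ge> 1" "size w \<ge> 1"
    by (simp_all add: Suc_le_eq nonempty_has_size)
  ultimately show False by linarith
qed

context
  fixes n :: nat and \<sigma> :: "nat \<Rightarrow> nat multiset set"
  assumes \<sigma>: "\<sigma> x \<in> carrier (divisor_alg (cycle n))"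
begin

interpretation A: comm_ai_semiring "divisor_alg (cycle n)"
  by (rule comm_ai_semiring_divisor_alg)

lemma mval_divisor_alg_cases:
  assumes "w \<noteq> []" "mval (divisor_alg (cycle n)) \<sigma> w \<noteq> {}"
  obtains (single) x where "w = [x]"
  | (pair) x y where "w = [x, y]" "mval (divisor_alg (cycle n)) \<sigma> w = setmul (\<sigma> x) (\<sigma> y)"
      "\<sigma> x \<noteq> {}" "\<sigma> y \<noteq> {}"
proof -
  consider x where "w = [x]" | x y where "w = [x, y]" | x y z v where "w = x # y # z # v"
    using assms(1) by (metis list.exhaust)
  then show thesis
  proof cases
    case 1
    then show thesis by (rule that(1))
  next
    case 2
    then show thesis
      using assms(2) clip_eq[of "cycle n" "setmul (\<sigma> x) (\<sigma> y)"] by (intro that(2)) auto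
  next
    case 3
    have c: "mval (divisor_alg (cycle n)) \<sigma> (z # v) \<in> carrier (divisor_alg (cycle n))"
      by (rule A.mval_closed[where \<sigma> = \<sigma>, OF \<sigma>]) simp
    have "mval (divisor_alg (cycle n)) \<sigma> w
        = mul (divisor_alg (cycle n)) (mul (divisor_alg (cycle n)) (\<sigma> x) (\<sigma> y))
            (mval (divisor_alg (cycle n)) \<sigma> (z # v))"
      by (simp only: 3 mval.simps A.mul_assoc[OF \<sigma> \<sigma> c])
    also have "\<dots> = {}"
      by (rule cube_divisor_alg_cycle[OF \<sigma> \<sigma> c])
    finally show thesis
      using assms(2) by simp
  qed
qed

text \<open>
  The vertex \<open>k\<close> occurs in no value of a variable of \<open>u\<close>. Deleting it leaves a path, whose
  2-colouring assigns colours to the variables of \<open>u\<close> that have sets of vertices as values.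
\<close>

lemma Sc_finite_if_divisor_alg_finite:
  assumes n: "odd n" and k: "k \<le> Suc n" "\<And>x. x \<in> set_gterm u \<Longrightarrow> {#k#} \<notin> \<sigma> x"
    and fin: "geval (divisor_alg (cycle n)) \<sigma> u \<noteq> {}"
  shows "\<exists>\<tau>. geval Sc_ab \<tau> u \<noteq> El_inf"
proof -
  define U where "U = geval (divisor_alg (cycle n)) \<sigma> u"
  have "U \<in> carrier (divisor_alg (cycle n))"
    unfolding U_def by (rule A.geval_in[where \<sigma> = \<sigma>, OF \<sigma>])
  then have U: "divisor (cycle n) U"
    using fin by (simp add: U_def)
  have mono: "mval (divisor_alg (cycle n)) \<sigma> w \<noteq> {}" "mval (divisor_alg (cycle n)) \<sigma> w \<subseteq> U" "w \<noteq> []"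
    if "w \<in> mons u" for w
    using le_divisor_alg[OF A.mval_le_geval[where \<sigma> = \<sigma>, OF \<sigma> that] fin] that Nil_not_in_mons
    unfolding U_def by blast+
  have pos: "size v \<ge> 1" if "v \<in> \<sigma> x" for v x
    using no_Nil[OF \<sigma>, of x] that by (metis Suc_le_eq One_nat_def nonempty_has_size)
  from U show ?thesis
  proof (cases rule: divisor_size)
    case 1
    have "mval Sc_ab (\<lambda>_. El_ab) w = El_ab" if w: "w \<in> mons u" for w
      using mono(3,1)[OF w]
    proof (cases rule: mval_divisor_alg_cases)
      case (pair x y)
      then obtain v v' where v: "v \<in> \<sigma> x" "v' \<in> \<sigma> y"
        by blast
      then have "v + v' \<in> U"
        using mono(2)[OF w] pair(2) by (auto simp: setmul_def)
      then have "size (v + v') = 1"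
        by (rule 1)
      then show ?thesis
        using pos[OF v(1)] pos[OF v(2)] by simp
    qed simp
    then have "geval Sc_ab (\<lambda>_. El_ab) u = El_ab"
      by (simp add: geval_Sc_eq_iff)
    then show ?thesis
      by (metis ab_elem.distinct(11))
  next
    case 2
    \<comment> \<open>alternate along the cycle and exchange the colours past \<open>k\<close>; as \<open>n + 1\<close> is even, the edge
      from \<open>n + 1\<close> to \<open>0\<close> is properly coloured by this exchange\<close>
    define col where "col i = (if even i \<longleftrightarrow> i < k then El_a else El_b)" for i :: nat
    have col: "{col i, col j} = {El_a, El_b}" if "{#i, j#} \<in> cycle n" "i \<noteq> k" "j \<noteq> k" for i j
      using that n k(1) unfolding edge_in_cycle_iff col_def by auto
    define \<tau> where "\<tau> x = (if \<sigma> x \<subseteq> cycle n then El_ab else col (SOME i. {#i#} \<in> \<sigma> x))" for x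
    have "mval Sc_ab \<tau> w = El_ab" if w: "w \<in> mons u" for w
      using mono(3,1)[OF w]
    proof (cases rule: mval_divisor_alg_cases)
      case (single x)
      then show ?thesis
        using subset_trans[OF mono(2)[OF w] 2] by (simp add: \<tau>_def)
    next
      case (pair x y)
      have vars: "x \<in> set_gterm u" "y \<in> set_gterm u"
        using UN_upper[OF w, of set] pair(1) by (simp_all add: set_mons)
      have edge: "v + v' \<in> cycle n" if "v \<in> \<sigma> x" "v' \<in> \<sigma> y" for v v'
        using that mono(2)[OF w] 2 pair(2) by (auto simp: setmul_def)
      have size: "size v = 1 \<and> size v' = 1" if "v \<in> \<sigma> x" "v' \<in> \<sigma> y" for v v'
        using size_cycle[OF edge[OF that]] pos[OF that(1)] pos[OF that(2)] by simp
      obtain v v' where v: "v \<in> \<sigma> x" "v' \<in> \<sigma> y"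
        using pair(3,4) by blast
      have "\<exists>i. {#i#} \<in> \<sigma> x" "\<exists>i. {#i#} \<in> \<sigma> y"
        using size[OF v] v by (metis size_1_singleton_mset)+
      then have i: "{#SOME i. {#i#} \<in> \<sigma> x#} \<in> \<sigma> x" "{#SOME i. {#i#} \<in> \<sigma> y#} \<in> \<sigma> y"
        by (metis someI_ex)+
      have "\<not> \<sigma> x \<subseteq> cycle n" "\<not> \<sigma> y \<subseteq> cycle n"
        using size[OF v] v size_cycle by fastforce+
      moreover have "{col (SOME i. {#i#} \<in> \<sigma> x), col (SOME i. {#i#} \<in> \<sigma> y)} = {El_a, El_b}"
      proof (rule col)
        show "{#SOME i. {#i#} \<in> \<sigma> x, SOME i. {#i#} \<in> \<sigma> y#} \<in> cycle n"
          using edge[OF i] by (simp add: add_mset_commute)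
      qed (use i k(2) vars in metis)+
      ultimately show ?thesis
        using pair(1) by (simp add: \<tau>_def)
    qed
    then have "geval Sc_ab \<tau> u = El_ab"
      by (simp add: geval_Sc_eq_iff)
    then show ?thesis
      by (metis ab_elem.distinct(11))
  qed
qed

text \<open>
  The vertices in the value of a variable have a common neighbour \<open>j\<close>.
\<close>

lemma card_vertices_le: "finite {i. {#i#} \<in> \<sigma> x} \<and> card {i. {#i#} \<in> \<sigma> x} \<le> 4"
proof (cases "\<exists>i. {#i#} \<in> \<sigma> x")
  case True
  then obtain i where i: "{#i#} \<in> \<sigma> x"
    by blast
  then have "divisor (cycle n) (\<sigma> x)"
    using \<sigma>[of x] by auto
  then obtain m where m: "\<And>w. w \<in> \<sigma> x \<Longrightarrow> w + m \<in> cycle n"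
    by (auto simp: divisor_def)
  have "size m = 1"
    using size_cycle[OF m[OF i]] by simp
  then obtain j where j: "m = {#j#}"
    using size_1_singleton_mset by blast
  have "{i. {#i#} \<in> \<sigma> x} \<subseteq> {Suc j, j - 1, 0, Suc n}"
  proof
    fix i assume "i \<in> {i. {#i#} \<in> \<sigma> x}"
    then have "{#i, j#} \<in> cycle n"
      using m[of "{#i#}"] j by (simp add: add_mset_commute[of i j])
    then show "i \<in> {Suc j, j - 1, 0, Suc n}"
      by (auto simp: edge_in_cycle_iff)
  qed
  moreover have "card {Suc j, j - 1, 0, Suc n} \<le> 4"
    using card_length[of "[Suc j, j - 1, 0, Suc n]"] by simp
  ultimately show ?thesis
    using finite_subset[of _ "{Suc j, j - 1, 0, Suc n}"] card_mono[of "{Suc j, j - 1, 0, Suc n}"]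
    by (meson finite.emptyI finite_insert le_trans)
qed simp

lemma ex_uncovered_vertex:
  assumes "finite X" "4 * card X < n + 2"
  shows "\<exists>k\<le>Suc n. \<forall>x\<in>X. {#k#} \<notin> \<sigma> x"
proof (rule ccontr)
  assume "\<not> ?thesis"
  then have "{..Suc n} \<subseteq> (\<Union>x\<in>X. {i. {#i#} \<in> \<sigma> x})"
    by auto
  then have "card {..Suc n} \<le> card (\<Union>x\<in>X. {i. {#i#} \<in> \<sigma> x})"
    using assms(1) card_vertices_le by (intro card_mono) auto
  also have "\<dots> \<le> (\<Sum>x\<in>X. card {i. {#i#} \<in> \<sigma> x})"
    by (rule card_UN_le[OF assms(1)])
  also have "\<dots> \<le> (\<Sum>x\<in>X. 4)"
    using card_vertices_le by (intro sum_mono) auto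
  finally show False
    using assms(2) by simp
qed

end

text \<open>
  A short term with finite value in the divisor algebra has a finite value in \<open>S\<^sub>c(ab)\<close> as well. As
  the path law fails, both sides of an identity then have the same monomials up to commutation.
\<close>

lemma geval_divisor_alg_eq_if_law:
  fixes u v :: "nat gterm" and \<sigma> :: "nat \<Rightarrow> nat multiset set"
  assumes n: "odd n" "4 * card (set_gterm u) < n + 2"
    and \<sigma>: "\<And>x. \<sigma> x \<in> carrier (divisor_alg (cycle n))"
    and S: "comm_ai_semiring S" "\<not> path_law S" "law S u v" and Sc: "law Sc_ab u v"
    and fin: "geval (divisor_alg (cycle n)) \<sigma> u \<noteq> {}"
  shows "geval (divisor_alg (cycle n)) \<sigma> u = geval (divisor_alg (cycle n)) \<sigma> v"
proof -
  interpret A: comm_ai_semiring "divisor_alg (cycle n)"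
    by (rule comm_ai_semiring_divisor_alg)
  note in_A = A.geval_in[where \<sigma> = \<sigma>, OF \<sigma>]
  have finite: "finite (set_gterm u)"
    by (induction u) auto
  obtain k where "k \<le> Suc n" "\<forall>x\<in>set_gterm u. {#k#} \<notin> \<sigma> x"
    using ex_uncovered_vertex[where \<sigma> = \<sigma>, OF \<sigma> finite n(2)] by blast
  then obtain \<tau> where \<tau>: "geval Sc_ab \<tau> u \<noteq> El_inf"
    using Sc_finite_if_divisor_alg_finite[where \<sigma> = \<sigma>, OF \<sigma> n(1) _ _ fin] by blast
  have \<tau>': "geval Sc_ab \<tau> v \<noteq> El_inf"
    using \<tau> Sc by (simp add: law_def)
  have le: "le (divisor_alg (cycle n)) (geval (divisor_alg (cycle n)) \<sigma> s) (geval (divisor_alg (cycle n)) \<sigma> t)"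
    if same: "\<And>w. w \<in> mons s \<Longrightarrow> w \<in> mons t \<or> (\<exists>x y. w = [x, y] \<and> [y, x] \<in> mons t)" for s t :: "nat gterm"
  proof (rule A.geval_le[where \<sigma> = \<sigma>, OF \<sigma> in_A])
    fix w assume "w \<in> mons s"
    then consider "w \<in> mons t" | x y where "w = [x, y]" "[y, x] \<in> mons t"
      using same by blast
    then show "le (divisor_alg (cycle n)) (mval (divisor_alg (cycle n)) \<sigma> w) (geval (divisor_alg (cycle n)) \<sigma> t)"
    proof cases
      case 1
      then show ?thesis by (rule A.mval_le_geval[where \<sigma> = \<sigma>, OF \<sigma>])
    next
      case 2
      have "mval (divisor_alg (cycle n)) \<sigma> w = mval (divisor_alg (cycle n)) \<sigma> [y, x]"
        using A.mul_comm[OF \<sigma> \<sigma>] by (simp only: 2(1) mval.simps)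
      then show ?thesis
        using A.mval_le_geval[where \<sigma> = \<sigma>, OF \<sigma> 2(2)] by simp
    qed
  qed
  show ?thesis
  proof (rule A.le_antisym)
    show "le (divisor_alg (cycle n)) (geval (divisor_alg (cycle n)) \<sigma> v) (geval (divisor_alg (cycle n)) \<sigma> u)"
      using law_fails_path_law[OF S Sc \<tau>] by (rule le)
    show "le (divisor_alg (cycle n)) (geval (divisor_alg (cycle n)) \<sigma> u) (geval (divisor_alg (cycle n)) \<sigma> v)"
      using law_fails_path_law[OF S(1,2) _ _ \<tau>'] S(3) Sc by (intro le) (simp_all add: law_sym)
  qed (rule in_A)+
qed

lemma satisfies_divisor_alg_cycle:
  assumes n: "odd n" "4 * card (set_gterm (gterm_of (fst e)) \<union> set_gterm (gterm_of (snd e))) < n + 2"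
    and S: "comm_ai_semiring S" "\<not> path_law S" "satisfies S e" and Sc: "satisfies Sc_ab e"
  shows "satisfies (divisor_alg (cycle n)) e"
  unfolding satisfies_iff_law law_def
proof (intro allI impI)
  let ?A = "divisor_alg (cycle n)" and ?u = "gterm_of (fst e)" and ?v = "gterm_of (snd e)"
  fix \<sigma> :: "nat \<Rightarrow> nat multiset set" assume "range \<sigma> \<subseteq> carrier ?A"
  then have \<sigma>: "\<sigma> x \<in> carrier ?A" for x
    by blast
  have fin: "finite (set_gterm t)" for t :: "nat gterm"
    by (induction t) auto
  have "card (set_gterm ?u) \<le> card (set_gterm ?u \<union> set_gterm ?v)"
    "card (set_gterm ?v) \<le> card (set_gterm ?u \<union> set_gterm ?v)"
    using fin by (auto intro!: card_mono)
  then have nu: "4 * card (set_gterm ?u) < n + 2" "4 * card (set_gterm ?v) < n + 2"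
    using n(2) by linarith+
  show "geval ?A \<sigma> ?u = geval ?A \<sigma> ?v"
  proof (cases "geval ?A \<sigma> ?u = {}")
    case False
    then show ?thesis
      using S Sc by (intro geval_divisor_alg_eq_if_law[OF n(1) nu(1) \<sigma>]) (simp_all add: satisfies_iff_law)
  next
    case u: True
    show ?thesis
    proof (cases "geval ?A \<sigma> ?v = {}")
      case False
      then have "geval ?A \<sigma> ?v = geval ?A \<sigma> ?u"
        using S Sc by (intro geval_divisor_alg_eq_if_law[OF n(1) nu(2) \<sigma>])
          (simp_all add: satisfies_iff_law law_sym)
      then show ?thesis by simp
    qed (simp add: u)
  qed
qed

text \<open>
  When every variable stands for the vertex of the same number, the sum of the edges of the cycle
  is a divisor, whereas the product of the vertices has too high a degree. The condition on \<open>n\<close>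
  makes this product one of three or more factors.
\<close>

lemma not_satisfies_cycle_divisor_alg:
  assumes "n \<ge> 1"
  shows "\<not> satisfies (divisor_alg (cycle n)) (law_cycle n)"
proof
  let ?A = "divisor_alg (cycle n)"
  interpret A: comm_ai_semiring ?A
    by (rule comm_ai_semiring_divisor_alg)
  assume sat: "satisfies ?A (law_cycle n)"
  define \<sigma> where "\<sigma> i = (if i \<le> Suc n then {{#i#}} else {})" for i :: nat
  have clip: "clip (cycle n) p = p" if "p \<subseteq> cycle n" "p \<noteq> {}" for p
  proof -
    have "{#} \<notin> p" "\<forall>w\<in>p. w + {#} \<in> cycle n"
      using that size_cycle by fastforce+
    then show ?thesis
      using that(2) unfolding clip_def divisor_def by (meson)
  qed
  have \<sigma>: "\<sigma> i \<in> carrier ?A" for i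
  proof -
    have "divisor (cycle n) {{#i#}}" if i: "i \<le> Suc n"
    proof -
      define j where "j = (if i = Suc n then 0 else Suc i)"
      have "{#i, j#} \<in> cycle n"
        using i by (auto simp: edge_in_cycle_iff j_def)
      then have "{#i#} + {#j#} \<in> cycle n"
        by (simp add: add_mset_commute[of j i])
      then show ?thesis unfolding divisor_def by fastforce
    qed
    then show ?thesis by (simp add: \<sigma>_def)
  qed
  have range: "range \<sigma> \<subseteq> carrier ?A"
    using \<sigma> by blast
  have mul: "mul ?A (\<sigma> i) (\<sigma> j) = {{#i, j#}}" if "{#i, j#} \<in> cycle n" for i j
  proof -
    have "i \<le> Suc n" "j \<le> Suc n"
      using that by (auto simp: edge_in_cycle_iff)
    then have "setmul (\<sigma> i) (\<sigma> j) = {{#i, j#}}"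
      by (simp add: \<sigma>_def setmul_def)
    then show ?thesis using that by (simp add: clip)
  qed
  have path: "eval ?A \<sigma> (path_trm k) = {{#i, Suc i#} | i. i \<le> k}" if "k \<le> n" for k
    using that
  proof (induction k)
    case 0
    then show ?case using mul[of 0 1] by (simp add: edge_in_cycle_iff)
  next
    case (Suc k)
    have "eval ?A \<sigma> (path_trm (Suc k)) = clip (cycle n) ({{#i, Suc i#} | i. i \<le> k} \<union> {{#Suc k, Suc (Suc k)#}})"
      using Suc mul[of "Suc k" "Suc (Suc k)"] by (auto simp: edge_in_cycle_iff)
    also have "\<dots> = {{#i, Suc i#} | i. i \<le> k} \<union> {{#Suc k, Suc (Suc k)#}}"
      using Suc.prems by (intro clip) (auto simp: cycle_def)
    also have "\<dots> = {{#i, Suc i#} | i. i \<le> Suc k}"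
      by (auto simp: le_Suc_eq)
    finally show ?case .
  qed
  have "eval ?A \<sigma> (cycle_trm n) = clip (cycle n) ({{#i, Suc i#} | i. i \<le> n} \<union> {{#Suc n, 0#}})"
    using mul[of "Suc n" 0] path[of n] by (auto simp: cycle_trm_def edge_in_cycle_iff)
  also have "\<dots> = {{#i, Suc i#} | i. i \<le> n} \<union> {{#Suc n, 0#}}"
    by (intro clip) (auto simp: cycle_def)
  finally have "eval ?A \<sigma> (cycle_trm n) \<noteq> {}"
    by blast
  moreover have "eval ?A \<sigma> (prod_trm (Suc n)) = {}"
  proof -
    obtain k where k: "n = Suc k"
      using assms by (cases n) auto
    have "eval ?A \<sigma> (prod_trm k) \<in> carrier ?A"
      unfolding geval_gterm_of[symmetric] by (rule A.geval_closed[OF range])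
    then show ?thesis
      using cube_divisor_alg_cycle[OF _ \<sigma> \<sigma>] by (simp only: k prod_trm.simps eval.simps)
  qed
  moreover have "eval ?A \<sigma> (fst (law_cycle n)) = eval ?A \<sigma> (snd (law_cycle n))"
    using sat range unfolding satisfies_def by blast
  ultimately show False
    by (simp add: law_cycle_def del: prod_trm.simps)
qed

text \<open>
  An identity of a variety that contains \<open>S\<^sub>c(ab)\<close> and violates the path law holds in the divisor
  algebra of every odd cycle that is long compared with the number of variables of the identity.
\<close>

lemma path_law_if_finitely_based:
  fixes K :: "'u::infinite alg set"
  assumes fb: "finitely_based K" and Sc: "copies Sc_ab \<subseteq> K"
    and cyc: "\<And>T n. T \<in> K \<Longrightarrow> odd n \<Longrightarrow> satisfies T (law_cycle n)"
    and S: "S \<in> K" "comm_ai_semiring S"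
  shows "path_law S"
proof (rule ccontr)
  assume not: "\<not> path_law S"
  obtain E where E: "finite E" "K = {T. ai_semiring T \<and> (\<forall>e\<in>E. satisfies T e)}"
    using fb by (auto simp: finitely_based_def)
  define N where "N = (\<Sum>e\<in>E. card (set_gterm (gterm_of (fst e)) \<union> set_gterm (gterm_of (snd e))))"
  \<comment> \<open>odd, and so large that no identity of \<open>E\<close> has enough variables to cover the cycle when each
    of them covers at most four vertices\<close>
  define n where "n = 4 * N + 1"
  have n: "odd n" "n \<ge> 1"
    by (simp_all add: n_def)
  obtain C :: "'u alg" where C: "C \<in> copies Sc_ab"
    using ex_copy[OF finite_Sc] by blast
  have "satisfies (divisor_alg (cycle n)) e" if e: "e \<in> E" for e
  proof (rule satisfies_divisor_alg_cycle[OF n(1) _ S(2) not])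
    have "card (set_gterm (gterm_of (fst e)) \<union> set_gterm (gterm_of (snd e))) \<le> N"
      unfolding N_def using E(1) e
      by (intro member_le_sum[where f = "\<lambda>e. card (set_gterm (gterm_of (fst e)) \<union> set_gterm (gterm_of (snd e)))"]) auto
    then show "4 * card (set_gterm (gterm_of (fst e)) \<union> set_gterm (gterm_of (snd e))) < n + 2"
      by (simp add: n_def)
    show "satisfies S e"
      using S(1) E(2) e by blast
    have "satisfies C e"
      using C Sc E(2) e by blast
    then show "satisfies Sc_ab e"
      by (simp add: satisfies_copies[OF ai_semiring_Sc_ab C])
  qed
  moreover obtain A :: "'u alg" where A: "A \<in> copies (divisor_alg (cycle n))"
    using ex_copy[OF finite_divisor_alg_cycle] by blast
  moreover have ai: "ai_semiring (divisor_alg (cycle n))"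
    using comm_ai_semiring_divisor_alg by (rule comm_ai_semiring.axioms(1))
  ultimately have "A \<in> K"
    using ai_semiring_copies[OF ai A] by (simp add: E(2) satisfies_copies[OF ai A])
  then have "satisfies A (law_cycle n)"
    using cyc n(1) by blast
  then have "satisfies (divisor_alg (cycle n)) (law_cycle n)"
    by (simp add: satisfies_copies[OF ai A])
  then show False
    using not_satisfies_cycle_divisor_alg[OF n(2)] by contradiction
qed

section \<open>The two intervals\<close>

text \<open>
  Both intervals fall under this scheme, with \<open>L\<close> the least and \<open>U\<close> the greatest member.
\<close>

lemma unique_finitely_based:
  fixes L U :: "'u::infinite alg set"
  assumes L: "variety L" "L \<subseteq> U" "finitely_based L" "copies Sc_ab \<subseteq> L"
    and U: "\<And>T. T \<in> U \<Longrightarrow> zero_model T" "\<And>T n. T \<in> U \<Longrightarrow> odd n \<Longrightarrow> satisfies T (law_cycle n)"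
    and path: "\<And>T. T \<in> U \<Longrightarrow> path_law T \<Longrightarrow> T \<in> L"
  shows "{K \<in> variety_interval L U. finitely_based K} = {L}"
proof
  show "{L} \<subseteq> {K \<in> variety_interval L U. finitely_based K}"
    using L by (simp add: variety_interval_def)
  show "{K \<in> variety_interval L U. finitely_based K} \<subseteq> {L}"
  proof
    fix K assume "K \<in> {K \<in> variety_interval L U. finitely_based K}"
    then have K: "L \<subseteq> K" "K \<subseteq> U" "finitely_based K"
      by (auto simp: variety_interval_def)
    have "K \<subseteq> L"
    proof
      fix T assume T: "T \<in> K"
      have "path_law T"
      proof (rule path_law_if_finitely_based[OF K(3) _ _ T])
        show "copies Sc_ab \<subseteq> K" using L(4) K(1) by blast
        show "satisfies T' (law_cycle n)" if "T' \<in> K" "odd n" for T' n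
          using U(2) that K(2) by blast
        show "comm_ai_semiring T"
          using U(1) T K(2) by (meson subsetD zero_model.axioms(1))
      qed
      then show "T \<in> L"
        using path T K(2) by blast
    qed
    then show "K \<in> {L}"
      using K(1) by blast
  qed
qed

text \<open>
  \<open>S\<close> satisfies all identities of the semiring with adjoined zero, so the inclusion follows from
  Birkhoff's theorem.
\<close>

lemma copies_subset_if_adjoin_zero:
  fixes U :: "'u::infinite alg set"
  assumes U: "variety U" "copies (adjoin_zero S) \<subseteq> U" and S: "ai_semiring S" "finite (carrier S)"
  shows "copies S \<subseteq> U"
proof
  fix T :: "'u alg" assume T: "T \<in> copies S"
  have "finite (carrier (adjoin_zero S))"
    using S(2) by simp
  from ex_copy[OF this] obtain C :: "'u alg" where C: "C \<in> copies (adjoin_zero S)"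
    by blast
  show "T \<in> U"
  proof (rule Birkhoff[OF U(1) ai_semiring_copies[OF S(1) T]])
    fix s t :: "'u gterm" assume laws: "\<And>S. S \<in> U \<Longrightarrow> law S s t"
    have "law C s t"
      using U(2) C by (intro laws) (rule subsetD)
    then have "law (adjoin_zero S) s t"
      unfolding law_copies[OF ai_semiring_adjoin_zero[OF S(1)] C] .
    then have "law S s t"
      by (rule law_if_adjoin_zero_law)
    then show "law T s t"
      unfolding law_copies[OF S(1) T] .
  qed
qed

lemma satisfies_copies_ai:
  assumes "ai_semiring S" "satisfies S e" "C \<in> copies S"
  shows "ai_semiring C \<and> satisfies C e"
  using ai_semiring_copies[OF assms(1,3)] assms(2) satisfies_copies[OF assms(1,3)] by simp

lemma finite_M2: "finite (carrier M2)"
  by (simp add: M2_def)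

lemma ai_semiring_generated:
  assumes "\<And>S. S \<in> G \<Longrightarrow> ai_semiring S" "T \<in> generated_variety G"
  shows "ai_semiring T"
  using variety_generated_variety[OF assms(1)] assms(2) unfolding variety_def by blast

lemma generated_Sc: "generated_variety (copies Sc_ab) = {T :: 'u::infinite alg. Sc_model T}"
proof -
  have ai: "ai_semiring C" if "C \<in> copies Sc_ab" for C :: "'u alg"
    using ai_semiring_copies[OF ai_semiring_Sc_ab that] .
  have "satisfies T e" if "e \<in> Sc_basis" "T \<in> generated_variety (copies Sc_ab)" for e and T :: "'u alg"
  proof (rule generated_variety_models[OF _ that(2)])
    have "satisfies Sc_ab e"
      using that(1) Sc_model_Sc Sc_model_iff by blast
    then show "ai_semiring C \<and> satisfies C e" if "C \<in> copies Sc_ab" for C :: "'u alg"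
      using satisfies_copies_ai[OF ai_semiring_Sc_ab _ that] by blast
  qed
  then have "Sc_model T" if "T \<in> generated_variety (copies Sc_ab)" for T :: "'u alg"
    using that ai_semiring_generated[OF ai that] by (simp add: Sc_model_iff)
  moreover have "T \<in> generated_variety (copies Sc_ab)" if "Sc_model T" for T :: "'u alg"
    using Sc_models_subset[OF variety_generated_variety[OF ai] subset_generated_variety that] .
  ultimately show ?thesis by blast
qed

lemma generated_M2_Sc:
  "generated_variety (copies M2 \<union> copies Sc_ab) = {T :: 'u::infinite alg. M2_Sc_model T}"
proof -
  have ai: "ai_semiring C" if "C \<in> copies M2 \<union> copies Sc_ab" for C :: "'u alg"
    using that ai_semiring_copies[OF ai_semiring_Sc_ab] ai_semiring_copies[OF ai_semiring_M2] by blast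
  have "satisfies T e" if "e \<in> M2_Sc_basis" "T \<in> generated_variety (copies M2 \<union> copies Sc_ab)"
    for e and T :: "'u alg"
  proof (rule generated_variety_models[OF _ that(2)])
    have "satisfies Sc_ab e" "satisfies M2 e"
      using that(1) Sc_model.axioms(1)[OF Sc_model_Sc] M2_Sc_model_M2 M2_Sc_model_iff by blast+
    then show "ai_semiring C \<and> satisfies C e" if "C \<in> copies M2 \<union> copies Sc_ab" for C :: "'u alg"
      using that satisfies_copies_ai[OF ai_semiring_Sc_ab \<open>satisfies Sc_ab e\<close>]
        satisfies_copies_ai[OF ai_semiring_M2 \<open>satisfies M2 e\<close>]
      by blast
  qed
  then have "M2_Sc_model T" if "T \<in> generated_variety (copies M2 \<union> copies Sc_ab)" for T :: "'u alg"
    using that ai_semiring_generated[OF ai that] by (simp add: M2_Sc_model_iff)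
  moreover have "T \<in> generated_variety (copies M2 \<union> copies Sc_ab)" if "M2_Sc_model T" for T :: "'u alg"
    using M2_Sc_models_subset[OF variety_generated_variety[OF ai] subset_generated_variety that] .
  ultimately show ?thesis by blast
qed

theorem corollary3p25:
  shows "{K \<in> variety_interval (generated_variety (copies Sc_ab))
              (generated_variety (copies (adjoin_zero Sc_ab))). finitely_based K}
      = {generated_variety (copies Sc_ab) :: 'u::infinite alg set}
    \<and> {K \<in> variety_interval (generated_variety (copies M2 \<union> copies Sc_ab))
              (generated_variety (copies (adjoin_zero M2) \<union> copies (adjoin_zero Sc_ab))).
            finitely_based K}
      = {generated_variety (copies M2 \<union> copies Sc_ab) :: 'u alg set}"
proof
  note ai_zero = ai_semiring_adjoin_zero[OF ai_semiring_Sc_ab] ai_semiring_adjoin_zero[OF ai_semiring_M2]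
  note copy_Sc = satisfies_copies_ai[OF ai_zero(1)] and copy_M2 = satisfies_copies_ai[OF ai_zero(2)]

  let ?U = "generated_variety (copies (adjoin_zero Sc_ab)) :: 'u alg set"
  have ai_U: "ai_semiring C" if "C \<in> copies (adjoin_zero Sc_ab)" for C :: "'u alg"
    using ai_semiring_copies[OF ai_zero(1) that] .
  have U: "satisfies T e" if "satisfies (adjoin_zero Sc_ab) e" "T \<in> ?U" for T e
    by (rule generated_variety_models[OF copy_Sc[OF that(1)] that(2)])
  have U_model: "zero_model T" if "T \<in> ?U" for T
    using ai_semiring_generated[OF ai_U that] U[OF satisfies_zero_laws[OF zero_model_Sc] that]
    by (rule zero_model_if_satisfies)
  show "{K \<in> variety_interval (generated_variety (copies Sc_ab)) ?U. finitely_based K}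
      = {generated_variety (copies Sc_ab)}"
  proof (rule unique_finitely_based)
    show "variety (generated_variety (copies Sc_ab) :: 'u alg set)"
      using ai_semiring_copies[OF ai_semiring_Sc_ab] by (rule variety_generated_variety)
    have U_variety: "variety ?U"
      using ai_U by (rule variety_generated_variety)
    show "generated_variety (copies Sc_ab) \<subseteq> ?U"
      using copies_subset_if_adjoin_zero[OF U_variety subset_generated_variety ai_semiring_Sc_ab finite_Sc]
      by (rule generated_variety_subset[OF U_variety])
    show "finitely_based (generated_variety (copies Sc_ab) :: 'u alg set)"
      unfolding generated_Sc Sc_model_iff finitely_based_def using finite_bases(2) by blast
    show "copies Sc_ab \<subseteq> (generated_variety (copies Sc_ab) :: 'u alg set)"
      by (rule subset_generated_variety)
    show "satisfies T (law_cycle n)" if "T \<in> ?U" "odd n" for T n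
      by (rule U[OF satisfies_odd_cycle(1)]) (rule that)+
    show "T \<in> generated_variety (copies Sc_ab)" if "T \<in> ?U" "path_law T" for T
      using zero_model.Sc_model_if_path_law[OF U_model[OF that(1)] that(2) U[OF satisfies_square_top that(1)]]
      by (simp add: generated_Sc)
  qed (rule U_model)

  let ?V = "generated_variety (copies (adjoin_zero M2) \<union> copies (adjoin_zero Sc_ab)) :: 'u alg set"
  have ai_V: "ai_semiring C" if "C \<in> copies (adjoin_zero M2) \<union> copies (adjoin_zero Sc_ab)" for C :: "'u alg"
    using that ai_zero[THEN ai_semiring_copies] by blast
  have V: "satisfies T e"
    if "satisfies (adjoin_zero Sc_ab) e" "satisfies (adjoin_zero M2) e" "T \<in> ?V" for T e
  proof (rule generated_variety_models[OF _ that(3)])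
    show "ai_semiring C \<and> satisfies C e"
      if "C \<in> copies (adjoin_zero M2) \<union> copies (adjoin_zero Sc_ab)" for C :: "'u alg"
      using that copy_Sc[OF \<open>satisfies (adjoin_zero Sc_ab) e\<close>] copy_M2[OF \<open>satisfies (adjoin_zero M2) e\<close>]
      by blast
  qed
  have V_model: "zero_model T" if "T \<in> ?V" for T
    using ai_semiring_generated[OF ai_V that]
      V[OF satisfies_zero_laws[OF zero_model_Sc] satisfies_zero_laws[OF zero_model_M2] that]
    by (rule zero_model_if_satisfies)
  show "{K \<in> variety_interval (generated_variety (copies M2 \<union> copies Sc_ab)) ?V. finitely_based K}
      = {generated_variety (copies M2 \<union> copies Sc_ab)}"
  proof (rule unique_finitely_based)
    show "variety (generated_variety (copies M2 \<union> copies Sc_ab) :: 'u alg set)"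
      using ai_semiring_copies[OF ai_semiring_Sc_ab] ai_semiring_copies[OF ai_semiring_M2]
      by (intro variety_generated_variety) blast
    have V_variety: "variety ?V"
      using ai_V by (rule variety_generated_variety)
    have sub: "copies (adjoin_zero M2) \<subseteq> ?V" "copies (adjoin_zero Sc_ab) \<subseteq> ?V"
      using subset_generated_variety by blast+
    have "copies M2 \<subseteq> ?V" "copies Sc_ab \<subseteq> ?V"
      using copies_subset_if_adjoin_zero[OF V_variety sub(1) ai_semiring_M2 finite_M2]
        copies_subset_if_adjoin_zero[OF V_variety sub(2) ai_semiring_Sc_ab finite_Sc] .
    then show "generated_variety (copies M2 \<union> copies Sc_ab) \<subseteq> ?V"
      by (intro generated_variety_subset[OF V_variety] Un_least)
    show "finitely_based (generated_variety (copies M2 \<union> copies Sc_ab) :: 'u alg set)"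
      unfolding generated_M2_Sc M2_Sc_model_iff finitely_based_def using finite_bases(1) by blast
    show "copies Sc_ab \<subseteq> (generated_variety (copies M2 \<union> copies Sc_ab) :: 'u alg set)"
      using subset_generated_variety by blast
    show "satisfies T (law_cycle n)" if "T \<in> ?V" "odd n" for T n
      by (rule V[OF satisfies_odd_cycle]) (rule that)+
    show "T \<in> generated_variety (copies M2 \<union> copies Sc_ab)" if "T \<in> ?V" "path_law T" for T
      using zero_model.M2_Sc_model_if_path_law[OF V_model[OF that(1)] that(2)]
      by (simp add: generated_M2_Sc)
  qed (rule V_model)
qed

end
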